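(* Let $d\ge 1$, let $(X_i)_{i\geq 1}$ be an i.i.d. sequence of random vectors in $\mathbb{R}^d$ that are centered ($\mathbb{E}[X_1]=0$) with unit covariance matrix ($\mathbb{E}[X_1X_1^T]=I_d$), and let $Z\sim\mathcal N(0,I_d)$. Let $\delta\in(0,1)$ be such that $\mathbb{E}[|X_1|^{2+\delta}]<\infty$. Then for every $n\ge 1$ (and any $i$, the $X_i$ being identically distributed) $$\mathcal W\left(n^{-1/2}\sum_{i=1}^n X_i,\, Z\right)\leq \frac{1}{n^{\frac{\delta}{2}}}\left[\left(K_1+2(1-\delta)^{-1}\right)\mathbb{E}|X_i|^{2+\delta}+\left(K_2+2d(1-\delta)^{-1}\right)\mathbb{E}|X_i|^{\delta}\right],$$ where $$K_1=2^{3/2}\,\frac{2d+1}{d}\,\frac{\Gamma\left(\frac{1+d}{2}\right)}{\Gamma(d/2)},\qquad K_2=2\sqrt{\frac{2}{\pi}}\,\sqrt d .$$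
   Context: $|\cdot|$ is the Euclidean norm on $\mathbb{R}^d$, and $\Gamma$ is the Gamma function. $\mathcal W$ is the $1$-Wasserstein distance between the laws of random vectors: $\mathcal W(X,Y)=\sup_{h}\left(\mathbb{E}\,h(X)-\mathbb{E}\,h(Y)\right)$, where the supremum is over all functions $h:\mathbb{R}^d\to\mathbb{R}$ that are Lipschitz with constant $1$ for the Euclidean norm. *)

theory Defs
  imports "HOL-Probability.Probability"
begin

text \<open>
  Kantorovich form of the 1-Wasserstein distance between two laws. The supremum is taken in
  the extended reals, so an unbounded family of test functions yields infinity rather than an
  unspecified real. The Bochner integral of a non-integrable function is 0, so the definition is
  meaningful only for laws with finite first moment, where every Lipschitz function is integrable.
\<close>

definition wasserstein :: "(real ^ 'd::finite) measure \<Rightarrow> (real ^ 'd) measure \<Rightarrow> ereal" where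
  "wasserstein \<mu> \<nu> = (SUP h \<in> {h :: real ^ 'd \<Rightarrow> real. 1-lipschitz_on UNIV h}.
     ereal ((\<integral>x. h x \<partial>\<mu>) - (\<integral>x. h x \<partial>\<nu>)))"

definition std_normal_vec_density :: "real ^ 'd::finite \<Rightarrow> real" where
  "std_normal_vec_density x = (2 * pi) powr (- real CARD('d) / 2) * exp (- (norm x)\<^sup>2 / 2)"

definition K1 :: "nat \<Rightarrow> real" where
  "K1 d = 2 powr (3 / 2) * ((2 * real d + 1) / real d) *
     (Gamma ((1 + real d) / 2) / Gamma (real d / 2))"

definition K2 :: "nat \<Rightarrow> real" where
  "K2 d = 2 * sqrt (2 / pi) * sqrt (real d)"

end

theory Submission
  imports Defs
begin

text \<open>
  Lindeberg's swapping argument. Write \<open>G\<^sub>\<sigma> h x = E h (x + \<sigma> Z)\<close> for Gaussian smoothing. Moving the shift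
  from \<open>h\<close> to the Gaussian density shows that, for 1-Lipschitz \<open>h\<close>, along a segment \<open>x\<close> the first derivative
  of \<open>G\<^sub>\<sigma> h\<close> is Lipschitz with constant \<open>|x|\<^sup>2 / \<sigma>\<close> and the second with constant \<open>2 |x|\<^sup>3 / \<sigma>\<^sup>2\<close>. Hence the
  second-order Taylor remainder is at most the minimum of \<open>|x|\<^sup>2 / \<sigma>\<close> and \<open>|x|\<^sup>3 / (3 \<sigma>\<^sup>2)\<close>, and therefore
  at most \<open>|x|\<close> to the power \<open>2 + \<delta>\<close> divided by \<open>3\<close> to the power \<open>\<delta>\<close> times \<open>\<sigma>\<close> to the power \<open>1 + \<delta>\<close>.
  Replacing the summands \<open>X\<^sub>k / sqrt n\<close> one at a time by Gaussians leaves the first two moments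
  unchanged, and the remaining Gaussian part smooths \<open>h\<close> at scale \<open>\<sigma> = sqrt ((n - k) / n)\<close>, so the errors
  sum to a constant times \<open>1 / (1 - \<delta>)\<close>. The last summand has no smoothing left and is swapped at the
  cost \<open>2 sqrt (d / n)\<close>; this is absorbed by \<open>K1\<close>, and \<open>K1 \<ge> 4\<close> is all that is used about the constants.
\<close>

section \<open>The standard Gaussian measure\<close>

text \<open>\<open>lborel\<close> on a Euclidean space is the image of a product of one-dimensional
  Lebesgue measures under assembling a vector from its coordinates, so Fubini integrates such a
  product factor by factor.\<close>

lemma
  fixes f :: "'a::euclidean_space \<Rightarrow> real \<Rightarrow> real"
  assumes f: "\<And>b. b \<in> Basis \<Longrightarrow> integrable lborel (f b)"
  shows lborel_integrable_prod: "integrable lborel (\<lambda>x. \<Prod>b\<in>Basis. f b (x \<bullet> b))"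
    and lborel_integral_prod:
      "(\<integral>x. (\<Prod>b\<in>Basis. f b (x \<bullet> b)) \<partial>lborel) = (\<Prod>b\<in>Basis. \<integral>x. f b x \<partial>lborel)"
proof -
  interpret product_sigma_finite "\<lambda>_::'a. lborel :: real measure"
    by standard
  have m [measurable]: "f b \<in> borel_measurable borel" if "b \<in> Basis" for b
    using f[OF that] by auto
  have m': "(\<lambda>x. \<Prod>b\<in>Basis. f b (x \<bullet> b)) \<in> borel_measurable borel"
    by measurable
  have s: "(\<Prod>b\<in>Basis. f b ((\<Sum>c\<in>Basis. g c *\<^sub>R c) \<bullet> b)) = (\<Prod>b\<in>Basis. f b (g b))" for g
    by (intro prod.cong refl) simp
  show "integrable lborel (\<lambda>x. \<Prod>b\<in>Basis. f b (x \<bullet> b))"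
    unfolding lborel_eq[where ?'a = 'a] using product_integrable_prod[of Basis f] f
    by (subst integrable_distr_eq[OF _ m']) (simp_all add: s)
  show "(\<integral>x. (\<Prod>b\<in>Basis. f b (x \<bullet> b)) \<partial>lborel) = (\<Prod>b\<in>Basis. \<integral>x. f b x \<partial>lborel)"
    using product_integral_prod[of Basis f] f
    by (subst lborel_eq, subst integral_distr[OF _ m']) (simp_all add: s)
qed

text \<open>The product form reduces Gaussian integrals of coordinatewise products to one dimension;
  the closed formula \<open>gauss_density_eq\<close> serves for shifts and rotations.\<close>

definition gauss_density :: "'a::euclidean_space \<Rightarrow> real" where
  "gauss_density x = (\<Prod>b\<in>Basis. std_normal_density (x \<bullet> b))"

definition gauss :: "'a::euclidean_space measure" where
  "gauss = density lborel (\<lambda>x. ennreal (gauss_density x))"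

lemma gauss_density_eq:
  "gauss_density (x::'a::euclidean_space) = (2 * pi) powr (- real DIM('a) / 2) * exp (- (norm x)\<^sup>2 / 2)"
proof -
  have "(norm x)\<^sup>2 = (\<Sum>b\<in>Basis. (x \<bullet> b)\<^sup>2)"
    unfolding power2_norm_eq_inner by (subst euclidean_inner) (simp add: power2_eq_square)
  moreover have "(1 / sqrt (2 * pi)) ^ DIM('a) = (2 * pi) powr (- real DIM('a) / 2)"
  proof -
    have "1 / sqrt (2 * pi) = (2 * pi) powr (- 1 / 2)"
      by (simp add: powr_minus_divide powr_half_sqrt)
    then show ?thesis
      by (simp add: powr_powr flip: powr_realpow)
  qed
  moreover have "gauss_density x = (1 / sqrt (2 * pi)) ^ DIM('a) * exp (\<Sum>b\<in>Basis. - (x \<bullet> b)\<^sup>2 / 2)"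
    by (simp only: gauss_density_def std_normal_density_def prod.distrib prod_constant exp_sum finite_Basis)
  ultimately show ?thesis
    by (simp add: sum_divide_distrib sum_negf)
qed

lemma gauss_density_nonneg [simp]: "0 \<le> gauss_density x"
  by (simp add: gauss_density_def prod_nonneg)

lemma borel_measurable_gauss_density [measurable]: "gauss_density \<in> borel_measurable borel"
  unfolding gauss_density_def [abs_def] by measurable

lemma sets_gauss [measurable_cong, simp]: "sets gauss = sets borel"
  by (simp add: gauss_def)

lemma space_gauss [simp]: "space gauss = UNIV"
  by (simp add: gauss_def)

lemma integrable_gauss_iff:
  fixes f :: "'a::euclidean_space \<Rightarrow> real"
  assumes [measurable]: "f \<in> borel_measurable borel"
  shows "integrable gauss f \<longleftrightarrow> integrable lborel (\<lambda>x. gauss_density x * f x)"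
  unfolding gauss_def by (subst integrable_density) auto

lemma integral_gauss_eq:
  fixes f :: "'a::euclidean_space \<Rightarrow> real"
  assumes [measurable]: "f \<in> borel_measurable borel"
  shows "(\<integral>x. f x \<partial>gauss) = (\<integral>x. gauss_density x * f x \<partial>lborel)"
  unfolding gauss_def by (subst integral_density) auto

lemma
  fixes f :: "'a::euclidean_space \<Rightarrow> real \<Rightarrow> real"
  assumes f: "\<And>b. b \<in> Basis \<Longrightarrow> integrable lborel (\<lambda>x. std_normal_density x * f b x)"
    and [measurable]: "\<And>b. b \<in> Basis \<Longrightarrow> f b \<in> borel_measurable borel"
  shows gauss_integrable_prod: "integrable gauss (\<lambda>x. \<Prod>b\<in>Basis. f b (x \<bullet> b))"
    and gauss_integral_prod:
      "(\<integral>x. (\<Prod>b\<in>Basis. f b (x \<bullet> b)) \<partial>gauss)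
        = (\<Prod>b\<in>Basis. \<integral>x. std_normal_density x * f b x \<partial>lborel)"
  using lborel_integrable_prod[of "\<lambda>b x. std_normal_density x * f b x"]
    lborel_integral_prod[of "\<lambda>b x. std_normal_density x * f b x"] f
  by (simp_all add: integrable_gauss_iff integral_gauss_eq gauss_density_def flip: prod.distrib)

text \<open>The first three lines make \<open>gauss\<close> a probability measure with mean zero and
  identity covariance; the fourth moment later bounds Gaussian moments of order 2 + \<delta> by
  interpolation.\<close>

lemma std_normal_moments:
  "has_bochner_integral lborel std_normal_density 1"
  "has_bochner_integral lborel (\<lambda>x. std_normal_density x * x) 0"
  "has_bochner_integral lborel (\<lambda>x. std_normal_density x * x\<^sup>2) 1"
  "has_bochner_integral lborel (\<lambda>x. std_normal_density x * x ^ 4) 3"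
  using normal_moment_even[of 1 0 0] normal_moment_odd[of 1 0 0] normal_moment_even[of 1 0 1]
    normal_moment_even[of 1 0 2]
  by (simp_all add: fact_numeral power2_eq_square)

lemma
  fixes b :: "'a::euclidean_space"
  assumes b: "b \<in> Basis" and [measurable]: "f \<in> borel_measurable borel"
    and f: "has_bochner_integral lborel (\<lambda>x. std_normal_density x * f x) r"
  shows gauss_integrable_coord: "integrable gauss (\<lambda>x::'a. f (x \<bullet> b))"
    and gauss_integral_coord: "(\<integral>x. f (x \<bullet> b) \<partial>(gauss :: 'a measure)) = r"
proof -
  define g where "g c x = (if c = b then f x else 1)" for c :: 'a and x
  have [measurable]: "g c \<in> borel_measurable borel" for c
    unfolding g_def by measurable
  have h: "has_bochner_integral lborel (\<lambda>x. std_normal_density x * g c x) (if c = b then r else 1)" for c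
    unfolding g_def using f std_normal_moments(1) by simp
  have i: "integrable lborel (\<lambda>x. std_normal_density x * g c x)" for c
    using h by (auto simp: has_bochner_integral_iff)
  have v: "(\<integral>x. std_normal_density x * g c x \<partial>lborel) = (if c = b then r else 1)" for c
    using h by (rule has_bochner_integral_integral_eq)
  have e: "(\<Prod>c\<in>Basis. g c (x \<bullet> c)) = f (x \<bullet> b)" for x
    using b by (simp add: g_def)
  show "integrable gauss (\<lambda>x::'a. f (x \<bullet> b))"
    using gauss_integrable_prod[of g] i by (simp add: e)
  show "(\<integral>x. f (x \<bullet> b) \<partial>(gauss :: 'a measure)) = r"
    using gauss_integral_prod[of g] i b by (simp add: e v)
qed

lemma
  fixes b c :: "'a::euclidean_space"
  assumes b: "b \<in> Basis" "c \<in> Basis"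
  shows gauss_integrable_coord_prod: "integrable gauss (\<lambda>x::'a. (x \<bullet> b) * (x \<bullet> c))"
    and gauss_integral_coord_prod:
      "(\<integral>x. (x \<bullet> b) * (x \<bullet> c) \<partial>(gauss :: 'a measure)) = (if b = c then 1 else 0)"
proof -
  \<comment> \<open>\<open>g\<close> carries one factor x for each of b and c, hence the square of x
    at b when b = c; \<open>r e\<close> is the one-dimensional Gaussian integral of
    \<open>g e\<close>, which vanishes at b and c when they differ.\<close>
  define g where "g e x = (if e = b then x else 1) * (if e = c then x else 1)" for e :: 'a and x :: real
  define r where "r e = (if b = c then 1 else if e = b \<or> e = c then 0 else 1::real)" for e :: 'a
  have [measurable]: "g c \<in> borel_measurable borel" for c
    unfolding g_def by measurable
  have h: "has_bochner_integral lborel (\<lambda>x. std_normal_density x * g e x) (r e)" for e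
    unfolding g_def r_def using std_normal_moments by (auto simp: power2_eq_square)
  have i: "integrable lborel (\<lambda>x. std_normal_density x * g c x)" for c
    using h by (auto simp: has_bochner_integral_iff)
  have v: "(\<integral>x. std_normal_density x * g c x \<partial>lborel) = r c" for c
    using h by (rule has_bochner_integral_integral_eq)
  have e: "(\<Prod>e\<in>Basis. g e (x \<bullet> e)) = (x \<bullet> b) * (x \<bullet> c)" for x
    using b by (simp add: g_def prod.distrib)
  show "integrable gauss (\<lambda>x::'a. (x \<bullet> b) * (x \<bullet> c))"
    using gauss_integrable_prod[of g] i by (simp add: e)
  have "(\<Prod>e\<in>Basis. r e) = (if b = c then 1 else 0)"
    using b by (auto simp: r_def prod_zero_iff)
  then show "(\<integral>x. (x \<bullet> b) * (x \<bullet> c) \<partial>(gauss :: 'a measure)) = (if b = c then 1 else 0)"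
    using gauss_integral_prod[of g] i by (simp add: e v)
qed

lemma prob_space_gauss: "prob_space (gauss :: 'a::euclidean_space measure)"
proof (rule prob_spaceI)
  have "(\<integral>\<^sup>+x. ennreal (gauss_density (x::'a)) \<partial>lborel)
      = (\<Prod>b\<in>(Basis::'a set). \<integral>\<^sup>+x. ennreal (std_normal_density x) \<partial>lborel)"
    unfolding gauss_density_def
    by (subst nn_integral_lborel_prod[symmetric]) (auto simp: prod_ennreal)
  also have "(\<integral>\<^sup>+x. ennreal (std_normal_density x) \<partial>lborel) = 1"
    using std_normal_moments(1) by (simp add: nn_integral_eq_integral has_bochner_integral_iff)
  finally show "emeasure gauss (space (gauss :: 'a measure)) = 1"
    by (simp add: gauss_def emeasure_density)
qed

section \<open>Differentiation under the integral and Taylor bounds\<close>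

text \<open>Dominated convergence for the difference quotients along an arbitrary sequence tending
  to a. By the mean value inequality on the interval of radius 1 around a, the bound
  \<open>w\<close> on the derivative also dominates the quotients.\<close>

lemma has_real_derivative_integral:
  fixes f f' :: "real \<Rightarrow> 'a \<Rightarrow> real"
  assumes int: "\<And>s. integrable M (f s)"
    and meas: "f' a \<in> borel_measurable M"
    and deriv: "\<And>s z. ((\<lambda>s. f s z) has_real_derivative f' s z) (at s)"
    and bound: "\<And>s z. \<bar>s - a\<bar> < 1 \<Longrightarrow> \<bar>f' s z\<bar> \<le> w z"
    and w: "integrable M w"
  shows "((\<lambda>s. \<integral>z. f s z \<partial>M) has_real_derivative (\<integral>z. f' a z \<partial>M)) (at a)"
proof -
  define S where "S = {a - 1 <..< a + 1}"
  have S: "open S" "a \<in> S" by (auto simp: S_def)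
  have lim: "(\<lambda>i. ((\<integral>z. f (X i) z \<partial>M) - (\<integral>z. f a z \<partial>M)) / (X i - a)) \<longlonglongrightarrow> (\<integral>z. f' a z \<partial>M)"
    if X: "\<forall>i. X i \<in> S - {a}" and Xa: "X \<longlonglongrightarrow> a" for X :: "nat \<Rightarrow> real"
  proof -
    have "(\<lambda>i. \<integral>z. (f (X i) z - f a z) / (X i - a) \<partial>M) \<longlonglongrightarrow> (\<integral>z. f' a z \<partial>M)"
    proof (rule integral_dominated_convergence[where w=w])
      show "(\<lambda>z. (f (X i) z - f a z) / (X i - a)) \<in> borel_measurable M" for i
        using int by auto
      have "filterlim X (at a) sequentially"
        using Xa X by (auto simp: filterlim_at)
      moreover have "((\<lambda>s. (f s z - f a z) / (s - a)) \<longlongrightarrow> f' a z) (at a)" for z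
        using deriv[of z a] by (simp add: has_field_derivative_iff)
      ultimately show "AE z in M. (\<lambda>i. (f (X i) z - f a z) / (X i - a)) \<longlonglongrightarrow> f' a z"
        using filterlim_compose by (intro AE_I2) blast
      have "norm ((f (X i) z - f a z) / (X i - a)) \<le> w z" for i z
      proof -
        have "norm (f (X i) z - f a z) \<le> w z * norm (X i - a)"
          using X S bound by (intro field_differentiable_bound[where S=S and f'="\<lambda>s. f' s z"])
            (auto simp: S_def abs_if intro!: has_field_derivative_at_within deriv)
        moreover have "X i \<noteq> a" using X by auto
        ultimately show ?thesis by (simp add: divide_simps mult.commute)
      qed
      then show "AE z in M. norm ((f (X i) z - f a z) / (X i - a)) \<le> w z" for i
        by simp
    qed (use meas w in auto)
    then show ?thesis using int by simp
  qed
  have "((\<lambda>s. ((\<integral>z. f s z \<partial>M) - (\<integral>z. f a z \<partial>M)) / (s - a)) \<longlongrightarrow> (\<integral>z. f' a z \<partial>M)) (at a within S)"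
    unfolding tendsto_at_iff_sequentially using lim by (simp add: o_def)
  then show ?thesis
    unfolding has_field_derivative_iff at_within_open[OF S(2,1)] .
qed

text \<open>Adding f to the antiderivative of the bound, or subtracting f from it, gives a function
  with nonnegative derivative on the half line, hence a nondecreasing one.\<close>

lemma abs_le_of_abs_deriv_le_power:
  fixes f f' :: "real \<Rightarrow> real"
  assumes d: "\<And>s. (f has_real_derivative f' s) (at s)" and f0: "f 0 = 0"
    and b: "\<And>s. 0 \<le> s \<Longrightarrow> \<bar>f' s\<bar> \<le> c * s ^ k" and s: "0 \<le> s"
  shows "\<bar>f s\<bar> \<le> c / Suc k * s ^ Suc k"
proof -
  have p: "((\<lambda>s. c / Suc k * s ^ Suc k) has_real_derivative c * r ^ k) (at r)" for r
    by (auto intro!: derivative_eq_intros simp del: power_Suc)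
  have "c / Suc k * 0 ^ Suc k - f 0 \<le> c / Suc k * s ^ Suc k - f s"
    using s
  proof (rule DERIV_nonneg_imp_nondecreasing)
    fix r assume "0 \<le> r" "r \<le> s"
    then show "\<exists>y. ((\<lambda>s. c / Suc k * s ^ Suc k - f s) has_real_derivative y) (at r) \<and> 0 \<le> y"
      using b[of r] by (intro exI[of _ "c * r ^ k - f' r"] conjI DERIV_diff[OF p d]) auto
  qed
  moreover have "c / Suc k * 0 ^ Suc k + f 0 \<le> c / Suc k * s ^ Suc k + f s"
    using s
  proof (rule DERIV_nonneg_imp_nondecreasing)
    fix r assume "0 \<le> r" "r \<le> s"
    then show "\<exists>y. ((\<lambda>s. c / Suc k * s ^ Suc k + f s) has_real_derivative y) (at r) \<and> 0 \<le> y"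
      using b[of r] by (intro exI[of _ "c * r ^ k + f' r"] conjI DERIV_add[OF p d]) auto
  qed
  ultimately show ?thesis using f0 by (simp add: abs_le_iff)
qed

lemma abs_deriv_le_lipschitz:
  fixes f :: "real \<Rightarrow> real"
  assumes d: "(f has_real_derivative D) (at a)" and l: "\<And>s. \<bar>f s - f a\<bar> \<le> K * \<bar>s - a\<bar>"
  shows "\<bar>D\<bar> \<le> K"
proof -
  have "((\<lambda>s. \<bar>(f s - f a) / (s - a)\<bar>) \<longlongrightarrow> \<bar>D\<bar>) (at a)"
    using d unfolding has_field_derivative_iff by (rule tendsto_rabs)
  moreover have "\<forall>\<^sub>F s in at a. \<bar>(f s - f a) / (s - a)\<bar> \<le> K"
    using l by (auto simp: eventually_at_filter divide_simps)
  ultimately show ?thesis by (intro tendsto_upperbound) auto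
qed

text \<open>The same second-order remainder is estimated in two ways. For K, the first-order
  remainder is at most K / 2 and the quadratic term is at most K / 2 because u'' is bounded by K.
  For L / 6, the Lipschitz bound on u'' is integrated twice.\<close>

lemma
  fixes u u' u'' :: "real \<Rightarrow> real"
  assumes d1: "\<And>s. (u has_real_derivative u' s) (at s)"
    and d2: "\<And>s. (u' has_real_derivative u'' s) (at s)"
    and l1: "\<And>s r. \<bar>u' s - u' r\<bar> \<le> K * \<bar>s - r\<bar>"
    and l2: "\<And>s r. \<bar>u'' s - u'' r\<bar> \<le> L * \<bar>s - r\<bar>"
  shows taylor2_lipschitz_deriv: "\<bar>u 1 - u 0 - u' 0 - u'' 0 / 2\<bar> \<le> K"
    and taylor2_lipschitz_deriv2: "\<bar>u 1 - u 0 - u' 0 - u'' 0 / 2\<bar> \<le> L / 6"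
proof -
  have l1': "\<bar>u' s - u' 0\<bar> \<le> K * s" and l2': "\<bar>u'' s - u'' 0\<bar> \<le> L * s" if "0 \<le> s" for s
    using l1[of s 0] l2[of s 0] that by simp_all
  have "\<bar>u 1 - u 0 - u' 0 * 1\<bar> \<le> K / Suc 1 * 1 ^ Suc 1"
    by (rule abs_le_of_abs_deriv_le_power[where f="\<lambda>s. u s - u 0 - u' 0 * s" and f'="\<lambda>s. u' s - u' 0"])
      (use l1' in \<open>auto intro!: derivative_eq_intros d1\<close>)
  moreover have "\<bar>u'' 0\<bar> \<le> K"
    using abs_deriv_le_lipschitz[OF d2 l1] .
  ultimately show "\<bar>u 1 - u 0 - u' 0 - u'' 0 / 2\<bar> \<le> K"
    using abs_triangle_ineq4[of "u 1 - u 0 - u' 0" "u'' 0 / 2"] by simp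
  have "\<bar>u' s - u' 0 - u'' 0 * s\<bar> \<le> L / Suc 1 * s ^ Suc 1" if "0 \<le> s" for s
    by (rule abs_le_of_abs_deriv_le_power[where f="\<lambda>s. u' s - u' 0 - u'' 0 * s" and f'="\<lambda>s. u'' s - u'' 0"])
      (use l2' that in \<open>auto intro!: derivative_eq_intros d2\<close>)
  then have "\<bar>u 1 - u 0 - u' 0 * 1 - u'' 0 / 2 * 1\<^sup>2\<bar> \<le> (L / Suc 1) / Suc 2 * 1 ^ Suc 2"
    by (intro abs_le_of_abs_deriv_le_power[where f="\<lambda>s. u s - u 0 - u' 0 * s - u'' 0 / 2 * s\<^sup>2"
          and f'="\<lambda>s. u' s - u' 0 - u'' 0 * s"])
      (auto intro!: derivative_eq_intros d1 simp: power2_eq_square)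
  then show "\<bar>u 1 - u 0 - u' 0 - u'' 0 / 2\<bar> \<le> L / 6"
    by simp
qed

section \<open>Gaussian tails and differentiation of integrals in a shift parameter\<close>

lemma integrable_exp_norm_square:
  assumes a: "0 < a"
  shows "integrable lborel (\<lambda>z::'a::euclidean_space. exp (- (a * (norm z)\<^sup>2)))"
proof -
  \<comment> \<open>Up to the factor sqrt (pi / a), the one-dimensional function is the normal
    density of variance 1 / (2 a).\<close>
  have "integrable lborel (\<lambda>x. normal_density 0 (1 / sqrt (2 * a)) x)"
    using normal_moment_even[of "1 / sqrt (2 * a)" 0 0] a by (simp add: has_bochner_integral_iff)
  then have "integrable lborel (\<lambda>x. sqrt (pi / a) * normal_density 0 (1 / sqrt (2 * a)) x)"
    by simp
  then have "integrable lborel (\<lambda>x. exp (- (a * x\<^sup>2)))"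
    using a by (simp add: normal_density_def real_sqrt_divide power_divide real_sqrt_mult field_simps)
  then have "integrable lborel (\<lambda>z::'a. \<Prod>b\<in>Basis. exp (- (a * (z \<bullet> b)\<^sup>2)))"
    by (intro lborel_integrable_prod) auto
  moreover have "(\<Prod>b\<in>Basis. exp (- (a * (z \<bullet> b)\<^sup>2))) = exp (- (a * (norm z)\<^sup>2))" for z :: 'a
  proof -
    have "(norm z)\<^sup>2 = (\<Sum>b\<in>Basis. (z \<bullet> b)\<^sup>2)"
      unfolding power2_norm_eq_inner by (subst euclidean_inner) (simp add: power2_eq_square)
    then show ?thesis
      by (simp add: sum_distrib_left flip: exp_sum sum_negf)
  qed
  ultimately show ?thesis by simp
qed

lemma le_exp_quarter_square: "r \<le> exp (r\<^sup>2 / 4)" for r :: real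
proof -
  have "0 \<le> (r / 2 - 1)\<^sup>2" by simp
  then have "r \<le> 1 + r\<^sup>2 / 4" by (simp add: power2_eq_square field_simps)
  then show ?thesis using exp_ge_add_one_self[of "r\<^sup>2 / 4"] by linarith
qed

text \<open>Half of the exponent absorbs the linear factor: norm z is at most twice exp of its
  square over 16. Functions of this shape dominate all integrands that are differentiated
  below.\<close>

lemma integrable_linear_exp_norm_square:
  "integrable lborel (\<lambda>z::'a::euclidean_space. (A + B * norm z) * exp (- (norm z)\<^sup>2 / 8))"
proof (rule Bochner_Integration.integrable_bound)
  have "integrable lborel (\<lambda>z::'a. exp (- (1 / 8 * (norm z)\<^sup>2)))" "integrable lborel (\<lambda>z::'a. exp (- (1 / 16 * (norm z)\<^sup>2)))"
    by (rule integrable_exp_norm_square, simp)+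
  then show "integrable lborel (\<lambda>z::'a. \<bar>A\<bar> * exp (- (1 / 8 * (norm z)\<^sup>2)) + 2 * \<bar>B\<bar> * exp (- (1 / 16 * (norm z)\<^sup>2)))"
    by simp
  show "AE z::'a in lborel. norm ((A + B * norm z) * exp (- (norm z)\<^sup>2 / 8))
      \<le> norm (\<bar>A\<bar> * exp (- (1 / 8 * (norm z)\<^sup>2)) + 2 * \<bar>B\<bar> * exp (- (1 / 16 * (norm z)\<^sup>2)))"
  proof (intro AE_I2)
    fix z :: 'a
    have "norm z \<le> 2 * exp ((norm z)\<^sup>2 / 16)"
      using le_exp_quarter_square[of "norm z / 2"] by (simp add: power_divide)
    then have "norm z * exp (- (norm z)\<^sup>2 / 8) \<le> 2 * exp ((norm z)\<^sup>2 / 16) * exp (- (norm z)\<^sup>2 / 8)"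
      by (intro mult_right_mono) auto
    also have "\<dots> = 2 * exp (- (1 / 16 * (norm z)\<^sup>2))"
      by (simp flip: exp_add)
    finally have 1: "\<bar>B\<bar> * (norm z * exp (- (norm z)\<^sup>2 / 8)) \<le> \<bar>B\<bar> * (2 * exp (- (1 / 16 * (norm z)\<^sup>2)))"
      by (rule mult_left_mono) simp
    have "\<bar>A + B * norm z\<bar> * exp (- (norm z)\<^sup>2 / 8) \<le> (\<bar>A\<bar> + \<bar>B\<bar> * norm z) * exp (- (norm z)\<^sup>2 / 8)"
      by (intro mult_right_mono) (auto intro: order_trans[OF abs_triangle_ineq] simp: abs_mult)
    then show "norm ((A + B * norm z) * exp (- (norm z)\<^sup>2 / 8))
      \<le> norm (\<bar>A\<bar> * exp (- (1 / 8 * (norm z)\<^sup>2)) + 2 * \<bar>B\<bar> * exp (- (1 / 16 * (norm z)\<^sup>2)))"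
      using 1 unfolding real_norm_def abs_mult abs_exp_cancel
      by (intro order_trans[OF _ abs_ge_self]) (simp add: distrib_right mult.assoc)
  qed
qed measurable

lemma lborel_integral_translation:
  fixes f :: "'a::euclidean_space \<Rightarrow> real"
  assumes [measurable]: "f \<in> borel_measurable borel"
  shows "(\<integral>z. f (z + a) \<partial>lborel) = (\<integral>z. f z \<partial>lborel)"
  using lborel_affine[of 1 a] integral_distr[of "\<lambda>z. a + z" lborel borel f]
  by (simp add: density_1 add.commute)

text \<open>Translating the integration variable moves the parameter s from H into \<psi>, so H
  needs no regularity beyond measurability and linear growth, and the derivative falls on
  \<psi>.\<close>

lemma
  fixes H \<psi> \<psi>' :: "'a::euclidean_space \<Rightarrow> real" and v :: 'a
  assumes H [measurable]: "H \<in> borel_measurable borel" and H_le: "\<And>z. \<bar>H z\<bar> \<le> A + B * norm z"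
    and [measurable]: "\<psi> \<in> borel_measurable borel" "\<psi>' \<in> borel_measurable borel"
    and deriv: "\<And>w s. ((\<lambda>s. \<psi> (w - s *\<^sub>R v)) has_real_derivative \<psi>' (w - s *\<^sub>R v)) (at s)"
    and \<psi>_le: "\<And>z. \<bar>\<psi> z\<bar> \<le> C * exp (- (norm z)\<^sup>2 / 4)"
    and \<psi>'_le: "\<And>z. \<bar>\<psi>' z\<bar> \<le> C * exp (- (norm z)\<^sup>2 / 4)"
  shows has_real_derivative_shift_integral:
    "((\<lambda>s. \<integral>z. \<psi> z * H (z + s *\<^sub>R v) \<partial>lborel) has_real_derivative
      (\<integral>z. \<psi>' z * H (z + a *\<^sub>R v) \<partial>lborel)) (at a)"
proof -
  have shift: "(\<integral>z. k z * H (z + s *\<^sub>R v) \<partial>lborel) = (\<integral>z. k (z - s *\<^sub>R v) * H z \<partial>lborel)"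
    if [measurable]: "k \<in> borel_measurable borel" for k s
    by (subst lborel_integral_translation[symmetric, where a="s *\<^sub>R v"]) simp_all
  \<comment> \<open>A dominating function for all shifts with \<bar>s\<bar> \<le> r. Since the
    square of norm z is at most twice the squares of the norms of z - s v and s v, a shift turns
    decay of rate 1/4 into rate 1/8 times a constant.\<close>
  define w where "w r z = C * exp ((r * norm v)\<^sup>2 / 4) * ((A + B * norm z) * exp (- (norm z)\<^sup>2 / 8))"
    for r and z :: 'a
  have C: "0 \<le> C"
    using \<psi>_le[of 0] by simp
  have w_int: "integrable lborel (w r)" for r
    unfolding w_def by (intro integrable_mult_right integrable_linear_exp_norm_square)
  have w_le: "\<bar>k (z - s *\<^sub>R v) * H z\<bar> \<le> w r z" if sr: "\<bar>s\<bar> \<le> r"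
    and k: "\<And>z. \<bar>k z\<bar> \<le> C * exp (- (norm z)\<^sup>2 / 4)" for k s r z
  proof -
    have "(norm z)\<^sup>2 \<le> (norm (z - s *\<^sub>R v) + norm (s *\<^sub>R v))\<^sup>2"
      using norm_triangle_ineq[of "z - s *\<^sub>R v" "s *\<^sub>R v"] by (intro power_mono) auto
    also have "\<dots> \<le> 2 * (norm (z - s *\<^sub>R v))\<^sup>2 + 2 * (norm (s *\<^sub>R v))\<^sup>2"
      using sum_squares_bound[of "norm (z - s *\<^sub>R v)" "norm (s *\<^sub>R v)"]
      by (simp add: power2_sum)
    also have "norm (s *\<^sub>R v) \<le> r * norm v"
      using sr by (simp add: mult_right_mono)
    then have "(norm (s *\<^sub>R v))\<^sup>2 \<le> (r * norm v)\<^sup>2"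
      by (intro power_mono) auto
    finally have "- (norm (z - s *\<^sub>R v))\<^sup>2 / 4 \<le> (r * norm v)\<^sup>2 / 4 + - (norm z)\<^sup>2 / 8"
      by simp
    then have "exp (- (norm (z - s *\<^sub>R v))\<^sup>2 / 4) \<le> exp ((r * norm v)\<^sup>2 / 4) * exp (- (norm z)\<^sup>2 / 8)"
      by (simp flip: exp_add)
    then have "\<bar>k (z - s *\<^sub>R v)\<bar> \<le> C * (exp ((r * norm v)\<^sup>2 / 4) * exp (- (norm z)\<^sup>2 / 8))"
      using C by (intro order_trans[OF k] mult_left_mono)
    then have "\<bar>k (z - s *\<^sub>R v)\<bar> * \<bar>H z\<bar>
        \<le> (C * (exp ((r * norm v)\<^sup>2 / 4) * exp (- (norm z)\<^sup>2 / 8))) * (A + B * norm z)"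
      using C by (intro mult_mono H_le) auto
    then show ?thesis
      by (simp add: w_def abs_mult mult_ac)
  qed
  have "((\<lambda>s. \<integral>z. \<psi> (z - s *\<^sub>R v) * H z \<partial>lborel) has_real_derivative
      (\<integral>z. \<psi>' (z - a *\<^sub>R v) * H z \<partial>lborel)) (at a)"
  proof (rule has_real_derivative_integral[where w="w (\<bar>a\<bar> + 1)"])
    show "integrable lborel (\<lambda>z. \<psi> (z - s *\<^sub>R v) * H z)" for s
      by (rule Bochner_Integration.integrable_bound[OF w_int[of "\<bar>s\<bar>"]])
        (auto intro!: AE_I2 order_trans[OF w_le[OF order_refl \<psi>_le]])
    show "\<bar>\<psi>' (z - s *\<^sub>R v) * H z\<bar> \<le> w (\<bar>a\<bar> + 1) z" if "\<bar>s - a\<bar> < 1" for s z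
      using that by (intro w_le \<psi>'_le) auto
  qed (auto intro!: w_int DERIV_cmult_right deriv)
  then show ?thesis
    by (simp add: shift)
qed

section \<open>Gaussian smoothing of Lipschitz functions\<close>

lemma gauss_density_le: "gauss_density z \<le> exp (- (norm (z::'a::euclidean_space))\<^sup>2 / 2)"
proof -
  have "(2 * pi) powr (- real DIM('a) / 2) \<le> (2 * pi) powr 0"
    using pi_ge_two by (intro powr_mono) auto
  then show ?thesis
    unfolding gauss_density_eq by (intro mult_left_le_one_le) auto
qed

text \<open>Half of the Gaussian exponent is spent on the weight r and the other half is kept as
  decay, which is the form that the shift lemma requires.\<close>

lemma gauss_density_mult_le:
  assumes "\<bar>r\<bar> \<le> C * exp ((norm z)\<^sup>2 / 4)"
  shows "\<bar>gauss_density z * r\<bar> \<le> C * exp (- (norm (z::'a::euclidean_space))\<^sup>2 / 4)"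
proof -
  have "\<bar>gauss_density z * r\<bar> \<le> exp (- (norm z)\<^sup>2 / 2) * (C * exp ((norm z)\<^sup>2 / 4))"
    unfolding abs_mult using assms gauss_density_le[of z] by (intro mult_mono) auto
  also have "\<dots> = C * exp (- (norm z)\<^sup>2 / 4)"
    by (simp flip: exp_add)
  finally show ?thesis .
qed

lemma integrable_gauss_mult:
  fixes H p :: "'a::euclidean_space \<Rightarrow> real"
  assumes [measurable]: "H \<in> borel_measurable borel" "p \<in> borel_measurable borel"
    and H: "\<And>z. \<bar>H z\<bar> \<le> A + B * norm z" and p: "\<And>z. \<bar>p z\<bar> \<le> C * exp ((norm z)\<^sup>2 / 4)"
  shows "integrable gauss (\<lambda>z. p z * H z)"
proof -
  have C: "0 \<le> C"
    using p[of 0] by simp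
  have "integrable lborel (\<lambda>z. gauss_density z * (p z * H z))"
  proof (rule Bochner_Integration.integrable_bound)
    show "integrable lborel (\<lambda>z::'a. C * ((A + B * norm z) * exp (- (norm z)\<^sup>2 / 8)))"
      by (intro integrable_mult_right integrable_linear_exp_norm_square)
    show "AE z in lborel. norm (gauss_density z * (p z * H z))
        \<le> norm (C * ((A + B * norm z) * exp (- (norm z)\<^sup>2 / 8)))"
    proof (intro AE_I2)
      fix z :: 'a
      have "\<bar>gauss_density z * p z\<bar> \<le> C * exp (- (norm z)\<^sup>2 / 8)"
        by (rule order_trans[OF gauss_density_mult_le[OF p]]) (auto intro!: mult_left_mono C)
      then have "\<bar>gauss_density z * p z\<bar> * \<bar>H z\<bar> \<le> (C * exp (- (norm z)\<^sup>2 / 8)) * (A + B * norm z)"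
        using C by (intro mult_mono H) auto
      also have "\<dots> \<le> \<bar>(C * exp (- (norm z)\<^sup>2 / 8)) * (A + B * norm z)\<bar>"
        by simp
      finally show "norm (gauss_density z * (p z * H z))
          \<le> norm (C * ((A + B * norm z) * exp (- (norm z)\<^sup>2 / 8)))"
        by (simp add: abs_mult mult_ac)
    qed
  qed measurable
  then show ?thesis
    by (subst integrable_gauss_iff) auto
qed

lemma
  fixes v :: "'a::euclidean_space"
  shows integrable_gauss_inner_square: "integrable gauss (\<lambda>z. (z \<bullet> v)\<^sup>2)"
    and gauss_inner_square: "(\<integral>z. (z \<bullet> v)\<^sup>2 \<partial>gauss) = (norm v)\<^sup>2"
proof -
  have e: "(z \<bullet> v)\<^sup>2 = (\<Sum>b\<in>Basis. \<Sum>c\<in>Basis. ((v \<bullet> b) * (v \<bullet> c)) * ((z \<bullet> b) * (z \<bullet> c)))" for z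
    unfolding power2_eq_square euclidean_inner[of z v] sum_product by (simp add: mult_ac)
  show "integrable gauss (\<lambda>z. (z \<bullet> v)\<^sup>2)"
    unfolding e by (intro Bochner_Integration.integrable_sum integrable_mult_right gauss_integrable_coord_prod)
  have "(\<integral>z. (z \<bullet> v)\<^sup>2 \<partial>gauss)
      = (\<Sum>b\<in>Basis. \<Sum>c\<in>Basis. ((v \<bullet> b) * (v \<bullet> c)) * (if b = c then 1 else 0))"
    unfolding e by (simp add: Bochner_Integration.integral_sum gauss_integrable_coord_prod gauss_integral_coord_prod
      cong: sum.cong)
  also have "\<dots> = (norm v)\<^sup>2"
    unfolding power2_norm_eq_inner by (subst (3) euclidean_inner) (simp add: if_distrib cong: if_cong)
  finally show "(\<integral>z. (z \<bullet> v)\<^sup>2 \<partial>gauss) = (norm v)\<^sup>2" .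
qed

text \<open>A pointwise arithmetic-geometric mean inequality takes the place of Cauchy-Schwarz: with
  norm v as the balancing weight, the two halves have equal Gaussian integrals.\<close>

lemma gauss_abs_inner_le: "(\<integral>z. \<bar>z \<bullet> v\<bar> \<partial>gauss) \<le> norm (v::'a::euclidean_space)"
proof (cases "v = 0")
  case False
  interpret prob_space "gauss :: 'a measure" by (rule prob_space_gauss)
  have le: "\<bar>z \<bullet> v\<bar> \<le> ((z \<bullet> v)\<^sup>2 / norm v + norm v) / 2" for z
    using sum_squares_bound[of "\<bar>z \<bullet> v\<bar>" "norm v"] False
    by (simp add: field_simps power2_eq_square)
  have i: "integrable gauss (\<lambda>z. ((z \<bullet> v)\<^sup>2 / norm v + norm v) / 2)"
    using integrable_gauss_inner_square[of v] by simp
  have "(\<integral>z. \<bar>z \<bullet> v\<bar> \<partial>gauss) \<le> (\<integral>z. ((z \<bullet> v)\<^sup>2 / norm v + norm v) / 2 \<partial>gauss)"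
    using le by (intro integral_mono Bochner_Integration.integrable_bound[OF i])
      (auto intro!: AE_I2 order_trans[OF _ abs_ge_self] i)
  also have "\<dots> = norm v"
    using integrable_gauss_inner_square[of v] False gauss_inner_square[of v]
    by (simp add: prob_space[unfolded space_gauss] power2_eq_square)
  finally show ?thesis .
qed simp

text \<open>The gradient of the density at x is -x times the density, and the sign cancels against
  that of the shift - s v.\<close>

lemma gauss_density_shift_deriv:
  fixes v w :: "'a::euclidean_space"
  shows "((\<lambda>s. gauss_density (w - s *\<^sub>R v)) has_real_derivative
    gauss_density (w - s *\<^sub>R v) * ((w - s *\<^sub>R v) \<bullet> v)) (at s)"
proof -
  have n: "(norm (w - s *\<^sub>R v))\<^sup>2 = w \<bullet> w - 2 * s * (w \<bullet> v) + s\<^sup>2 * (v \<bullet> v)" for s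
    unfolding power2_norm_eq_inner by (simp add: inner_diff inner_commute power2_eq_square algebra_simps)
  show ?thesis
    unfolding gauss_density_eq n
    by (auto intro!: derivative_eq_intros simp: inner_diff field_simps)
qed

text \<open>Gaussian integration by parts: differentiating in s replaces the weight p by p'.
  Starting from p = 1 this produces the Hermite weights z \<bullet> v and
  \<open>(z \<bullet> v) * (z \<bullet> v) - v \<bullet> v\<close>.\<close>

lemma has_real_derivative_gauss_shift:
  fixes H p p' :: "'a::euclidean_space \<Rightarrow> real" and v :: 'a
  assumes [measurable]: "H \<in> borel_measurable borel" "p \<in> borel_measurable borel" "p' \<in> borel_measurable borel"
    and H: "\<And>z. \<bar>H z\<bar> \<le> A + B * norm z"
    and p: "\<And>z. \<bar>p z\<bar> \<le> C * exp ((norm z)\<^sup>2 / 4)"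
    and p': "\<And>z. \<bar>p' z\<bar> \<le> C * exp ((norm z)\<^sup>2 / 4)"
    and deriv: "\<And>w s. ((\<lambda>s. gauss_density (w - s *\<^sub>R v) * p (w - s *\<^sub>R v)) has_real_derivative
      gauss_density (w - s *\<^sub>R v) * p' (w - s *\<^sub>R v)) (at s)"
  shows "((\<lambda>s. \<integral>z. p z * H (z + s *\<^sub>R v) \<partial>gauss) has_real_derivative
      (\<integral>z. p' z * H (z + a *\<^sub>R v) \<partial>gauss)) (at a)"
  using has_real_derivative_shift_integral[OF assms(1) H _ _ deriv
    gauss_density_mult_le[OF p] gauss_density_mult_le[OF p'], of a]
  by (simp add: integral_gauss_eq mult.assoc)

text \<open>The value \<sigma> = 0 is meaningful and returns h itself; it is the state after all
  summands have been swapped.\<close>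

definition gauss_smooth :: "real \<Rightarrow> ('a::euclidean_space \<Rightarrow> real) \<Rightarrow> 'a \<Rightarrow> real" where
  "gauss_smooth \<sigma> h x = (\<integral>z. h (x + \<sigma> *\<^sub>R z) \<partial>gauss)"

lemma lipschitz_abs_le: "1-lipschitz_on UNIV h \<Longrightarrow> \<bar>h x - h y\<bar> \<le> norm (x - y)"
  for h :: "'a::real_normed_vector \<Rightarrow> real"
  using lipschitz_onD[of 1 UNIV h x y] by (simp add: dist_norm)

lemma lipschitz_borel_measurable: "1-lipschitz_on UNIV h \<Longrightarrow> h \<in> borel_measurable borel"
  for h :: "'a::euclidean_space \<Rightarrow> real"
  by (intro borel_measurable_continuous_onI lipschitz_on_continuous_on)

text \<open>A second-order Taylor expansion at t. The coefficients are written in coordinates and do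
  not depend on x, so that the polynomial can be integrated against a law knowing only its first two
  moments.\<close>

lemma gauss_smooth_expansion:
  fixes h :: "'a::euclidean_space \<Rightarrow> real"
  assumes h: "1-lipschitz_on UNIV h" and \<sigma>: "0 < \<sigma>"
  obtains l q where
    "\<And>x. \<bar>gauss_smooth \<sigma> h (t + x) - gauss_smooth \<sigma> h t - (\<Sum>b\<in>Basis. l b * (x \<bullet> b))
        - (\<Sum>b\<in>Basis. \<Sum>c\<in>Basis. q b c * ((x \<bullet> b) * (x \<bullet> c)))\<bar> \<le> (norm x)\<^sup>2 / \<sigma>"
    "\<And>x. \<bar>gauss_smooth \<sigma> h (t + x) - gauss_smooth \<sigma> h t - (\<Sum>b\<in>Basis. l b * (x \<bullet> b))
        - (\<Sum>b\<in>Basis. \<Sum>c\<in>Basis. q b c * ((x \<bullet> b) * (x \<bullet> c)))\<bar> \<le> norm x ^ 3 / (3 * \<sigma>\<^sup>2)"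
proof -
  interpret prob_space "gauss :: 'a measure" by (rule prob_space_gauss)
  note [measurable] = lipschitz_borel_measurable[OF h]
  \<comment> \<open>In units of \<sigma>, moving the base point from t to t + x shifts the argument
    of H by v = x / \<sigma>, and H is \<sigma>-Lipschitz.\<close>
  define H where "H z = h (t + \<sigma> *\<^sub>R z)" for z
  have Hm [measurable]: "H \<in> borel_measurable borel"
    unfolding H_def by measurable
  have Hd: "\<bar>H y - H z\<bar> \<le> \<sigma> * norm (y - z)" for y z
    using lipschitz_abs_le[OF h, of "t + \<sigma> *\<^sub>R y" "t + \<sigma> *\<^sub>R z"] \<sigma>
    by (simp add: H_def flip: scaleR_right_diff_distrib)
  have H: "\<bar>H z\<bar> \<le> \<bar>H 0\<bar> + \<sigma> * norm z" for z
    using Hd[of z 0] by simp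
  have Hs: "\<bar>H (z + y)\<bar> \<le> (\<bar>H 0\<bar> + \<sigma> * norm y) + \<sigma> * norm z" for z y
  proof -
    have "\<sigma> * norm (z + y) \<le> \<sigma> * (norm z + norm y)"
      using \<sigma> by (intro mult_left_mono norm_triangle_ineq) auto
    then show ?thesis using H[of "z + y"] by (simp add: algebra_simps)
  qed
  have e1: "1 \<le> exp ((norm z)\<^sup>2 / 4)" "norm z \<le> exp ((norm z)\<^sup>2 / 4)"
      "(norm z)\<^sup>2 \<le> 4 * exp ((norm z)\<^sup>2 / 4)" for z :: 'a
  proof -
    show "norm z \<le> exp ((norm z)\<^sup>2 / 4)"
      by (rule le_exp_quarter_square)
    show "1 \<le> exp ((norm z)\<^sup>2 / 4)"
      by simp
    show "(norm z)\<^sup>2 \<le> 4 * exp ((norm z)\<^sup>2 / 4)"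
      using exp_ge_add_one_self[of "(norm z)\<^sup>2 / 4"] by linarith
  qed
  have p1: "\<bar>z \<bullet> v\<bar> \<le> norm v * exp ((norm z)\<^sup>2 / 4)" for z v :: 'a
    using Cauchy_Schwarz_ineq2[of z v] mult_left_mono[OF e1(2)[of z], of "norm v"]
    by (simp add: mult.commute)
  have p2: "\<bar>(z \<bullet> v) * (z \<bullet> w) - v \<bullet> w\<bar> \<le> 5 * (norm v * norm w) * exp ((norm z)\<^sup>2 / 4)" for z v w :: 'a
  proof -
    have "\<bar>(z \<bullet> v) * (z \<bullet> w)\<bar> \<le> (norm z * norm v) * (norm z * norm w)"
      unfolding abs_mult by (intro mult_mono Cauchy_Schwarz_ineq2) auto
    also have "\<dots> = (norm v * norm w) * (norm z)\<^sup>2"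
      by (simp add: power2_eq_square)
    also have "\<dots> \<le> (norm v * norm w) * (4 * exp ((norm z)\<^sup>2 / 4))"
      by (intro mult_left_mono e1) auto
    finally have "\<bar>(z \<bullet> v) * (z \<bullet> w)\<bar> \<le> (norm v * norm w) * (4 * exp ((norm z)\<^sup>2 / 4))" .
    moreover have "\<bar>v \<bullet> w\<bar> \<le> (norm v * norm w) * exp ((norm z)\<^sup>2 / 4)"
      using Cauchy_Schwarz_ineq2[of v w] mult_left_mono[OF e1(1)[of z], of "norm v * norm w"]
      by simp
    ultimately show ?thesis
      using abs_triangle_ineq4[of "(z \<bullet> v) * (z \<bullet> w)" "v \<bullet> w"] by (simp add: algebra_simps)
  qed
  have int1: "integrable gauss (\<lambda>z. (z \<bullet> v) * H (z + y))" for v y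
    by (rule integrable_gauss_mult[OF _ _ Hs p1]) measurable
  have int2: "integrable gauss (\<lambda>z. ((z \<bullet> v) * (z \<bullet> w) - v \<bullet> w) * H (z + y))" for v w y
    by (rule integrable_gauss_mult[OF _ _ Hs p2]) measurable
  \<comment> \<open>First derivatives and half the second derivatives of the smoothed function at t.
    One factor 1 / \<sigma> arises for each derivative from v = x / \<sigma>, and the 2 is that of
    Taylor's formula.\<close>
  define l where "l b = (\<integral>z. (z \<bullet> b) * H z \<partial>gauss) / \<sigma>" for b
  define q where "q b c = (\<integral>z. ((z \<bullet> b) * (z \<bullet> c) - b \<bullet> c) * H z \<partial>gauss) / (2 * \<sigma>\<^sup>2)" for b c
  have main: "\<bar>gauss_smooth \<sigma> h (t + x) - gauss_smooth \<sigma> h t - (\<Sum>b\<in>Basis. l b * (x \<bullet> b))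
        - (\<Sum>b\<in>Basis. \<Sum>c\<in>Basis. q b c * ((x \<bullet> b) * (x \<bullet> c)))\<bar> \<le> (norm x)\<^sup>2 / \<sigma> \<and>
     \<bar>gauss_smooth \<sigma> h (t + x) - gauss_smooth \<sigma> h t - (\<Sum>b\<in>Basis. l b * (x \<bullet> b))
        - (\<Sum>b\<in>Basis. \<Sum>c\<in>Basis. q b c * ((x \<bullet> b) * (x \<bullet> c)))\<bar> \<le> norm x ^ 3 / (3 * \<sigma>\<^sup>2)" for x
  proof -
    define v where "v = (1 / \<sigma>) *\<^sub>R x"
    have \<sigma>v: "x = \<sigma> *\<^sub>R v" "norm v = norm x / \<sigma>"
      using \<sigma> by (simp_all add: v_def)
    \<comment> \<open>\<open>u\<close> is the smoothed function along the segment from t to t + x;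
      \<open>u'\<close> and \<open>u''\<close> are its derivatives with the Hermite weights of order
      one and two. The factor 1 in \<open>u\<close> fits the form of
      \<open>has_real_derivative_gauss_shift\<close>.\<close>
    define u where "u s = (\<integral>z. 1 * H (z + s *\<^sub>R v) \<partial>gauss)" for s
    define u' where "u' s = (\<integral>z. (z \<bullet> v) * H (z + s *\<^sub>R v) \<partial>gauss)" for s
    define u'' where "u'' s = (\<integral>z. ((z \<bullet> v) * (z \<bullet> v) - v \<bullet> v) * H (z + s *\<^sub>R v) \<partial>gauss)" for s
    have Hsd: "\<bar>H (z + s *\<^sub>R v) - H (z + r *\<^sub>R v)\<bar> \<le> \<sigma> * norm v * \<bar>s - r\<bar>" for z s r
      using Hd[of "z + s *\<^sub>R v" "z + r *\<^sub>R v"]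
      by (simp add: mult_ac flip: scaleR_left_diff_distrib)
    have "(u has_real_derivative u' s) (at s)" for s
      unfolding u_def u'_def
    proof (rule has_real_derivative_gauss_shift[where A="\<bar>H 0\<bar>" and B=\<sigma> and C="1 + norm v"])
      show "\<bar>1\<bar> \<le> (1 + norm v) * exp ((norm z)\<^sup>2 / 4)" for z :: 'a
        using mult_mono[of 1 "1 + norm v" 1 "exp ((norm z)\<^sup>2 / 4)"] by simp
      show "\<bar>z \<bullet> v\<bar> \<le> (1 + norm v) * exp ((norm z)\<^sup>2 / 4)" for z
        by (intro order_trans[OF p1] mult_right_mono) auto
      show "((\<lambda>s. gauss_density (w - s *\<^sub>R v) * 1) has_real_derivative
          gauss_density (w - s *\<^sub>R v) * ((w - s *\<^sub>R v) \<bullet> v)) (at s)" for w s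
        using gauss_density_shift_deriv[of w v s] by simp
    qed (auto simp: H)
    moreover have "(u' has_real_derivative u'' s) (at s)" for s
      unfolding u'_def u''_def
    proof (rule has_real_derivative_gauss_shift[where A="\<bar>H 0\<bar>" and B=\<sigma> and C="norm v + 5 * (norm v * norm v)"])
      show "\<bar>z \<bullet> v\<bar> \<le> (norm v + 5 * (norm v * norm v)) * exp ((norm z)\<^sup>2 / 4)" for z
        by (intro order_trans[OF p1] mult_right_mono) auto
      show "\<bar>(z \<bullet> v) * (z \<bullet> v) - v \<bullet> v\<bar> \<le> (norm v + 5 * (norm v * norm v)) * exp ((norm z)\<^sup>2 / 4)" for z
        by (intro order_trans[OF p2] mult_right_mono) auto
      show "((\<lambda>s. gauss_density (w - s *\<^sub>R v) * ((w - s *\<^sub>R v) \<bullet> v)) has_real_derivative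
          gauss_density (w - s *\<^sub>R v) * (((w - s *\<^sub>R v) \<bullet> v) * ((w - s *\<^sub>R v) \<bullet> v) - v \<bullet> v)) (at s)" for w s
      proof -
        have i: "(w - s *\<^sub>R v) \<bullet> v = w \<bullet> v - s * (v \<bullet> v)" for s
          by (simp add: inner_diff)
        have "((\<lambda>s. (w - s *\<^sub>R v) \<bullet> v) has_real_derivative - (v \<bullet> v)) (at s)"
          unfolding i by (auto intro!: derivative_eq_intros)
        from DERIV_mult[OF gauss_density_shift_deriv[of w v s] this] show ?thesis
          by (simp add: algebra_simps)
      qed
    qed (auto simp: H)
    \<comment> \<open>Only the Lipschitz property of H enters: its increment is at most \<sigma> *
      norm v * \<bar>s - r\<bar>, and the weight z \<bullet> v has mean absolute value at most norm
      v. With norm v = norm x / \<sigma> this is the claimed constant.\<close>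
    moreover have "\<bar>u' s - u' r\<bar> \<le> ((norm x)\<^sup>2 / \<sigma>) * \<bar>s - r\<bar>" for s r
    proof -
      have "\<bar>u' s - u' r\<bar> = \<bar>\<integral>z. (z \<bullet> v) * (H (z + s *\<^sub>R v) - H (z + r *\<^sub>R v)) \<partial>gauss\<bar>"
        unfolding u'_def by (simp add: int1 right_diff_distrib)
      also have "\<dots> \<le> (\<integral>z. \<bar>(z \<bullet> v) * (H (z + s *\<^sub>R v) - H (z + r *\<^sub>R v))\<bar> \<partial>gauss)"
        by (rule integral_abs_bound)
      also have "\<dots> \<le> (\<integral>z. \<bar>z \<bullet> v\<bar> * (\<sigma> * norm v * \<bar>s - r\<bar>) \<partial>gauss)"
      proof (rule integral_mono)
        show "integrable gauss (\<lambda>z. \<bar>(z \<bullet> v) * (H (z + s *\<^sub>R v) - H (z + r *\<^sub>R v))\<bar>)"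
          by (intro integrable_abs) (simp add: int1 right_diff_distrib)
        show "integrable gauss (\<lambda>z. \<bar>z \<bullet> v\<bar> * (\<sigma> * norm v * \<bar>s - r\<bar>))"
          using integrable_gauss_mult[of "\<lambda>_. 1" "\<lambda>z. z \<bullet> v" 1 0 "norm v"] p1
          by (intro integrable_mult_left integrable_abs) simp
      qed (auto simp: abs_mult intro!: mult_left_mono Hsd)
      also have "\<dots> = (\<integral>z. \<bar>z \<bullet> v\<bar> \<partial>gauss) * (\<sigma> * norm v * \<bar>s - r\<bar>)"
        by simp
      also have "\<dots> \<le> norm v * (\<sigma> * norm v * \<bar>s - r\<bar>)"
        using \<sigma> by (intro mult_right_mono gauss_abs_inner_le) auto
      also have "\<dots> = ((norm x)\<^sup>2 / \<sigma>) * \<bar>s - r\<bar>"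
        using \<sigma> by (simp add: \<sigma>v(2) power2_eq_square)
      finally show ?thesis .
    qed
    \<comment> \<open>The same argument with the second Hermite weight, whose absolute value is at
      most the sum of the squares of z \<bullet> v and norm v; both have Gaussian integral equal to
      the square of norm v, which gives the factor 2.\<close>
    moreover have "\<bar>u'' s - u'' r\<bar> \<le> (2 * norm x ^ 3 / \<sigma>\<^sup>2) * \<bar>s - r\<bar>" for s r
    proof -
      have "\<bar>u'' s - u'' r\<bar>
          = \<bar>\<integral>z. ((z \<bullet> v) * (z \<bullet> v) - v \<bullet> v) * (H (z + s *\<^sub>R v) - H (z + r *\<^sub>R v)) \<partial>gauss\<bar>"
        unfolding u''_def by (simp only: int2 right_diff_distrib Bochner_Integration.integral_diff)
      also have "\<dots> \<le> (\<integral>z. \<bar>((z \<bullet> v) * (z \<bullet> v) - v \<bullet> v) * (H (z + s *\<^sub>R v) - H (z + r *\<^sub>R v))\<bar> \<partial>gauss)"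
        by (rule integral_abs_bound)
      also have "\<dots> \<le> (\<integral>z. ((z \<bullet> v)\<^sup>2 + (norm v)\<^sup>2) * (\<sigma> * norm v * \<bar>s - r\<bar>) \<partial>gauss)"
      proof (rule integral_mono)
        show "integrable gauss (\<lambda>z. \<bar>((z \<bullet> v) * (z \<bullet> v) - v \<bullet> v) * (H (z + s *\<^sub>R v) - H (z + r *\<^sub>R v))\<bar>)"
          by (intro integrable_abs) (simp only: int2 right_diff_distrib Bochner_Integration.integrable_diff)
        show "integrable gauss (\<lambda>z. ((z \<bullet> v)\<^sup>2 + (norm v)\<^sup>2) * (\<sigma> * norm v * \<bar>s - r\<bar>))"
          by (intro integrable_mult_left Bochner_Integration.integrable_add integrable_gauss_inner_square) simp
        show "\<bar>((z \<bullet> v) * (z \<bullet> v) - v \<bullet> v) * (H (z + s *\<^sub>R v) - H (z + r *\<^sub>R v))\<bar>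
            \<le> ((z \<bullet> v)\<^sup>2 + (norm v)\<^sup>2) * (\<sigma> * norm v * \<bar>s - r\<bar>)" for z
          unfolding abs_mult
        proof (rule mult_mono[OF _ Hsd])
          show "\<bar>(z \<bullet> v) * (z \<bullet> v) - v \<bullet> v\<bar> \<le> (z \<bullet> v)\<^sup>2 + (norm v)\<^sup>2"
            using abs_triangle_ineq4[of "(z \<bullet> v) * (z \<bullet> v)" "v \<bullet> v"]
            by (simp add: power2_norm_eq_inner power2_eq_square[of "z \<bullet> v"])
        qed auto
      qed
      also have "\<dots> = ((norm v)\<^sup>2 + (norm v)\<^sup>2) * (\<sigma> * norm v * \<bar>s - r\<bar>)"
        by (simp add: integrable_gauss_inner_square gauss_inner_square prob_space[unfolded space_gauss])
      also have "\<dots> = (2 * norm x ^ 3 / \<sigma>\<^sup>2) * \<bar>s - r\<bar>"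
        using \<sigma> by (simp add: \<sigma>v(2) power2_eq_square power3_eq_cube)
      finally show ?thesis .
    qed
    ultimately have "\<bar>u 1 - u 0 - u' 0 - u'' 0 / 2\<bar> \<le> (norm x)\<^sup>2 / \<sigma>"
      "\<bar>u 1 - u 0 - u' 0 - u'' 0 / 2\<bar> \<le> (2 * norm x ^ 3 / \<sigma>\<^sup>2) / 6"
      by (rule taylor2_lipschitz_deriv, rule taylor2_lipschitz_deriv2)
    moreover have "u 1 = gauss_smooth \<sigma> h (t + x)" "u 0 = gauss_smooth \<sigma> h t"
      by (simp_all add: u_def gauss_smooth_def H_def \<sigma>v(1) algebra_simps)
    moreover have "u' 0 = (\<Sum>b\<in>Basis. l b * (x \<bullet> b))"
    proof -
      have "(z \<bullet> v) * H z = (\<Sum>b\<in>Basis. (v \<bullet> b) * ((z \<bullet> b) * H z))" for z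
        by (subst euclidean_inner) (simp add: sum_distrib_left mult_ac)
      then have "u' 0 = (\<Sum>b\<in>Basis. (v \<bullet> b) * (\<integral>z. (z \<bullet> b) * H z \<partial>gauss))"
        using int1[of _ 0] by (simp add: u'_def Bochner_Integration.integral_sum)
      then show ?thesis
        by (simp add: l_def v_def mult_ac)
    qed
    moreover have "u'' 0 / 2 = (\<Sum>b\<in>Basis. \<Sum>c\<in>Basis. q b c * ((x \<bullet> b) * (x \<bullet> c)))"
    proof -
      have "((z \<bullet> v) * (z \<bullet> v) - v \<bullet> v) * H z
          = (\<Sum>b\<in>Basis. \<Sum>c\<in>Basis. ((v \<bullet> b) * (v \<bullet> c)) * (((z \<bullet> b) * (z \<bullet> c) - b \<bullet> c) * H z))" for z
      proof -
        have 1: "(z \<bullet> v) * (z \<bullet> v) = (\<Sum>b\<in>Basis. \<Sum>c\<in>Basis. ((v \<bullet> b) * (v \<bullet> c)) * ((z \<bullet> b) * (z \<bullet> c)))"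
          unfolding euclidean_inner[of z v] sum_product by (simp add: mult_ac)
        have 2: "v \<bullet> v = (\<Sum>b\<in>Basis. \<Sum>c\<in>Basis. ((v \<bullet> b) * (v \<bullet> c)) * (b \<bullet> c))"
          by (subst euclidean_inner) (simp add: inner_Basis if_distrib cong: if_cong)
        show ?thesis
          unfolding 1 2 by (simp add: sum_distrib_left right_diff_distrib left_diff_distrib sum_subtractf mult_ac)
      qed
      then have "u'' 0 = (\<Sum>b\<in>Basis. \<Sum>c\<in>Basis. ((v \<bullet> b) * (v \<bullet> c)) *
          (\<integral>z. ((z \<bullet> b) * (z \<bullet> c) - b \<bullet> c) * H z \<partial>gauss))"
        using int2[of _ _ 0] by (simp add: u''_def Bochner_Integration.integral_sum)
      then show ?thesis
        using \<sigma> by (simp add: q_def v_def sum_divide_distrib power2_eq_square mult_ac)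
    qed
    ultimately show ?thesis by simp
  qed
  show thesis
    using main by (intro that[of l q]) auto
qed

section \<open>Isotropic measures\<close>

text \<open>Geometric interpolation: the remainder is split as its power 1 - \<delta> times its
  power \<delta>, with the quadratic bound used on the first factor and the cubic bound on the
  second.\<close>

lemma gauss_smooth_expansion_powr:
  fixes h :: "'a::euclidean_space \<Rightarrow> real"
  assumes h: "1-lipschitz_on UNIV h" and \<sigma>: "0 < \<sigma>"
  obtains l q where
    "\<And>x \<delta>. 0 \<le> \<delta> \<Longrightarrow> \<delta> \<le> 1 \<Longrightarrow>
      \<bar>gauss_smooth \<sigma> h (t + x) - gauss_smooth \<sigma> h t - (\<Sum>b\<in>Basis. l b * (x \<bullet> b))
        - (\<Sum>b\<in>Basis. \<Sum>c\<in>Basis. q b c * ((x \<bullet> b) * (x \<bullet> c)))\<bar>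
      \<le> norm x powr (2 + \<delta>) / (3 powr \<delta> * \<sigma> powr (1 + \<delta>))"
proof -
  obtain l q where
    b1: "\<And>x. \<bar>gauss_smooth \<sigma> h (t + x) - gauss_smooth \<sigma> h t - (\<Sum>b\<in>Basis. l b * (x \<bullet> b))
        - (\<Sum>b\<in>Basis. \<Sum>c\<in>Basis. q b c * ((x \<bullet> b) * (x \<bullet> c)))\<bar> \<le> (norm x)\<^sup>2 / \<sigma>" (is "\<And>x. ?R x \<le> _")
    and b2: "\<And>x. \<bar>gauss_smooth \<sigma> h (t + x) - gauss_smooth \<sigma> h t - (\<Sum>b\<in>Basis. l b * (x \<bullet> b))
        - (\<Sum>b\<in>Basis. \<Sum>c\<in>Basis. q b c * ((x \<bullet> b) * (x \<bullet> c)))\<bar> \<le> norm x ^ 3 / (3 * \<sigma>\<^sup>2)"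
    by (rule gauss_smooth_expansion[OF h \<sigma>, of t]) blast
  have "?R x \<le> norm x powr (2 + \<delta>) / (3 powr \<delta> * \<sigma> powr (1 + \<delta>))" if \<delta>: "0 \<le> \<delta>" "\<delta> \<le> 1" for x \<delta>
  \<comment> \<open>The exponent rules for \<open>powr\<close> are applied to positive bases. At x =
    0 the quadratic bound already forces the remainder to vanish.\<close>
  proof (cases "?R x = 0 \<or> x = 0")
    case True
    then show ?thesis using b1[of 0] by (elim disjE) (simp_all del: abs_le_zero_iff)
  next
    case False
    define r where "r = ?R x"
    define n where "n = norm x"
    have r: "0 < r" and n: "0 < n" using False by (auto simp: r_def n_def)
    have "r = r powr (1 - \<delta>) * r powr \<delta>"
      using r by (simp flip: powr_add)
    also have "\<dots> \<le> (n\<^sup>2 / \<sigma>) powr (1 - \<delta>) * (n ^ 3 / (3 * \<sigma>\<^sup>2)) powr \<delta>"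
      using r \<delta> b1[of x] b2[of x] by (intro mult_mono powr_mono2) (auto simp: r_def n_def)
    also have "\<dots> = n powr (2 * (1 - \<delta>) + 3 * \<delta>) / (3 powr \<delta> * \<sigma> powr ((1 - \<delta>) + 2 * \<delta>))"
    proof -
      have "(y ^ 2) powr a = y powr (2 * a)" "(y ^ 3) powr a = y powr (3 * a)" if "0 < y" for y a :: real
        using that by (simp_all flip: powr_powr)
      then have "(n\<^sup>2 / \<sigma>) powr (1 - \<delta>) = n powr (2 * (1 - \<delta>)) / \<sigma> powr (1 - \<delta>)"
        "(n ^ 3 / (3 * \<sigma>\<^sup>2)) powr \<delta> = n powr (3 * \<delta>) / (3 powr \<delta> * \<sigma> powr (2 * \<delta>))"
        using n \<sigma> by (simp_all add: powr_divide powr_mult)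
      then show ?thesis
        by (simp only: powr_add times_divide_times_eq mult_ac)
    qed
    also have "\<dots> = n powr (2 + \<delta>) / (3 powr \<delta> * \<sigma> powr (1 + \<delta>))"
      by (simp add: algebra_simps)
    finally show ?thesis by (simp add: r_def n_def)
  qed
  then show thesis by (rule that)
qed

text \<open>Captures what the law of a summand and the Gaussian have in common, so that each
  estimate below is proved once and used for both. Integrability of single coordinates follows from
  that of the squares.\<close>

locale isotropic_measure = prob_space \<mu> for \<mu> :: "'a::euclidean_space measure" +
  assumes sets_eq_borel [measurable_cong, simp]: "sets \<mu> = sets borel"
    and mean_zero: "b \<in> Basis \<Longrightarrow> (\<integral>x. x \<bullet> b \<partial>\<mu>) = 0"
    and integrable_coord_prod: "b \<in> Basis \<Longrightarrow> c \<in> Basis \<Longrightarrow> integrable \<mu> (\<lambda>x. (x \<bullet> b) * (x \<bullet> c))"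
    and integral_coord_prod:
      "b \<in> Basis \<Longrightarrow> c \<in> Basis \<Longrightarrow> (\<integral>x. (x \<bullet> b) * (x \<bullet> c) \<partial>\<mu>) = (if b = c then 1 else 0)"
begin

lemma space_eq_UNIV [simp]: "space \<mu> = UNIV"
  using sets_eq_imp_space_eq[OF sets_eq_borel] by simp

lemma prob_UNIV [simp]: "prob UNIV = 1"
  using prob_space by simp

lemma integrable_norm_square: "integrable \<mu> (\<lambda>x. (norm x)\<^sup>2)"
  and integral_norm_square: "(\<integral>x. (norm x)\<^sup>2 \<partial>\<mu>) = DIM('a)"
proof -
  have e: "(norm x)\<^sup>2 = (\<Sum>b\<in>Basis. (x \<bullet> b) * (x \<bullet> b))" for x :: 'a
    unfolding power2_norm_eq_inner by (subst euclidean_inner) simp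
  show "integrable \<mu> (\<lambda>x. (norm x)\<^sup>2)"
    unfolding e by (intro Bochner_Integration.integrable_sum integrable_coord_prod)
  show "(\<integral>x. (norm x)\<^sup>2 \<partial>\<mu>) = DIM('a)"
    unfolding e by (simp add: integrable_coord_prod integral_coord_prod)
qed

lemma integrable_norm: "integrable \<mu> norm"
proof (rule Bochner_Integration.integrable_bound)
  show "integrable \<mu> (\<lambda>x. 1 + (norm x)\<^sup>2)"
    using integrable_norm_square by simp
  have "norm x \<le> 1 + (norm x)\<^sup>2" for x :: 'a
    using sum_squares_bound[of 1 "norm x"] by simp (smt (verit) norm_ge_zero)
  then show "AE x in \<mu>. norm (norm x) \<le> norm (1 + (norm x)\<^sup>2)"
    by simp
qed measurable

text \<open>Jensen's inequality for the square, obtained from the arithmetic-geometric mean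
  inequality with weight d, the square root of the dimension.\<close>

lemma integral_norm_le: "(\<integral>x. norm x \<partial>\<mu>) \<le> sqrt DIM('a)"
proof -
  define d where "d = sqrt DIM('a)"
  have d: "0 < d" "d * d = DIM('a)" by (simp_all add: d_def)
  have "norm x \<le> ((norm x)\<^sup>2 / d + d) / 2" for x :: 'a
    using sum_squares_bound[of "norm x" d] d by (simp add: field_simps power2_eq_square)
  then have "(\<integral>x. norm x \<partial>\<mu>) \<le> (\<integral>x. ((norm x)\<^sup>2 / d + d) / 2 \<partial>\<mu>)"
    using integrable_norm integrable_norm_square by (intro integral_mono) auto
  also have "\<dots> = d"
    using integrable_norm_square d by (simp add: integral_norm_square flip: d(2))
  finally show ?thesis by (simp add: d_def)
qed

lemma integrable_lipschitz:
  fixes f :: "'a \<Rightarrow> real"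
  assumes f: "1-lipschitz_on UNIV f"
  shows "integrable \<mu> (\<lambda>x. f (t + c *\<^sub>R x))"
proof (rule Bochner_Integration.integrable_bound)
  note [measurable] = lipschitz_borel_measurable[OF f]
  show "integrable \<mu> (\<lambda>x. \<bar>f t\<bar> + \<bar>c\<bar> * norm x)"
    using integrable_norm by simp
  have "\<bar>f (t + c *\<^sub>R x)\<bar> \<le> \<bar>f t\<bar> + \<bar>c\<bar> * norm x" for x
    using lipschitz_abs_le[OF f, of "t + c *\<^sub>R x" t] by simp
  then show "AE x in \<mu>. norm (f (t + c *\<^sub>R x)) \<le> norm (\<bar>f t\<bar> + \<bar>c\<bar> * norm x)"
    by (simp add: order_trans)
  show "(\<lambda>x. f (t + c *\<^sub>R x)) \<in> borel_measurable \<mu>"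
    by measurable
qed

lemma lipschitz_integral_shift:
  fixes f :: "'a \<Rightarrow> real"
  assumes f: "1-lipschitz_on UNIV f"
  shows "1-lipschitz_on UNIV (\<lambda>t. \<integral>x. f (t + c *\<^sub>R x) \<partial>\<mu>)"
proof (rule lipschitz_onI)
  fix s t
  have "\<bar>(\<integral>x. f (s + c *\<^sub>R x) \<partial>\<mu>) - (\<integral>x. f (t + c *\<^sub>R x) \<partial>\<mu>)\<bar>
      = \<bar>\<integral>x. f (s + c *\<^sub>R x) - f (t + c *\<^sub>R x) \<partial>\<mu>\<bar>"
    by (simp add: integrable_lipschitz[OF f])
  also have "\<dots> \<le> (\<integral>x. \<bar>f (s + c *\<^sub>R x) - f (t + c *\<^sub>R x)\<bar> \<partial>\<mu>)"
    by (rule integral_abs_bound)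
  also have "\<dots> \<le> (\<integral>x. norm (s - t) \<partial>\<mu>)"
    using lipschitz_abs_le[OF f, of "s + c *\<^sub>R x" "t + c *\<^sub>R x" for x]
    by (intro integral_mono) (auto simp: integrable_lipschitz[OF f])
  finally show "dist (\<integral>x. f (s + c *\<^sub>R x) \<partial>\<mu>) (\<integral>x. f (t + c *\<^sub>R x) \<partial>\<mu>) \<le> 1 * dist s t"
    by (simp add: dist_norm)
qed simp

text \<open>A first-moment estimate for the last swap, where h itself must be compared and has no
  derivatives to expand.\<close>

lemma integral_shift_diff_le:
  fixes f :: "'a \<Rightarrow> real"
  assumes f: "1-lipschitz_on UNIV f"
  shows "\<bar>(\<integral>x. f (t + c *\<^sub>R x) \<partial>\<mu>) - f t\<bar> \<le> \<bar>c\<bar> * sqrt DIM('a)"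
proof -
  have "\<bar>(\<integral>x. f (t + c *\<^sub>R x) \<partial>\<mu>) - f t\<bar> = \<bar>\<integral>x. f (t + c *\<^sub>R x) - f t \<partial>\<mu>\<bar>"
    by (simp add: integrable_lipschitz[OF f])
  also have "\<dots> \<le> (\<integral>x. \<bar>f (t + c *\<^sub>R x) - f t\<bar> \<partial>\<mu>)"
    by (rule integral_abs_bound)
  also have "\<dots> \<le> (\<integral>x. \<bar>c\<bar> * norm x \<partial>\<mu>)"
    using lipschitz_abs_le[OF f, of "t + c *\<^sub>R x" t for x] integrable_norm
    by (intro integral_mono) (auto simp: integrable_lipschitz[OF f])
  also have "\<dots> \<le> \<bar>c\<bar> * sqrt DIM('a)"
    using integral_norm_le by (simp add: mult_left_mono)
  finally show ?thesis .
qed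

text \<open>Integrating the expansion at e x kills the linear part and leaves only the trace of q.
  The value \<open>g t + e\<^sup>2 * (\<Sum>b\<in>Basis. q b b)\<close> is the same for all
  isotropic laws, so it cancels when two of them are compared.\<close>

lemma integral_remainder_le:
  fixes g :: "'a \<Rightarrow> real"
  assumes bound: "\<And>x. \<bar>g (t + x) - g t - (\<Sum>b\<in>Basis. l b * (x \<bullet> b))
        - (\<Sum>b\<in>Basis. \<Sum>c\<in>Basis. q b c * ((x \<bullet> b) * (x \<bullet> c)))\<bar> \<le> C * norm x powr (2 + \<delta>)"
    and g: "1-lipschitz_on UNIV g"
    and m: "integrable \<mu> (\<lambda>x. norm x powr (2 + \<delta>))" and e: "0 < e"
  shows "\<bar>(\<integral>x. g (t + e *\<^sub>R x) \<partial>\<mu>) - (g t + e\<^sup>2 * (\<Sum>b\<in>Basis. q b b))\<bar>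
    \<le> C * e powr (2 + \<delta>) * (\<integral>x. norm x powr (2 + \<delta>) \<partial>\<mu>)"
proof -
  define R where "R x = g (t + e *\<^sub>R x) - g t - (\<Sum>b\<in>Basis. l b * e * (x \<bullet> b))
        - (\<Sum>b\<in>Basis. \<Sum>c\<in>Basis. (q b c * e\<^sup>2) * ((x \<bullet> b) * (x \<bullet> c)))" for x
  have ic: "integrable \<mu> (\<lambda>x. x \<bullet> b)" for b
    by (rule Bochner_Integration.integrable_bound[OF integrable_mult_left[OF integrable_norm, of "norm b"]])
      (auto intro!: AE_I2 Cauchy_Schwarz_ineq2)
  have "integrable \<mu> R \<and> (\<integral>x. R x \<partial>\<mu>)
      = (\<integral>x. g (t + e *\<^sub>R x) \<partial>\<mu>) - g t - (\<Sum>b\<in>Basis. \<Sum>c\<in>Basis. (q b c * e\<^sup>2) * (if b = c then 1 else 0))"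
    unfolding R_def
    by (simp add: ic integrable_coord_prod integral_coord_prod mean_zero integrable_lipschitz[OF g] cong: sum.cong)
  then have iR: "integrable \<mu> R" and
    R: "(\<integral>x. R x \<partial>\<mu>) = (\<integral>x. g (t + e *\<^sub>R x) \<partial>\<mu>) - (g t + e\<^sup>2 * (\<Sum>b\<in>Basis. q b b))"
    by (simp_all add: if_distrib sum_distrib_left mult.commute cong: if_cong)
  have Rle: "\<bar>R x\<bar> \<le> C * e powr (2 + \<delta>) * norm x powr (2 + \<delta>)" for x
    using bound[of "e *\<^sub>R x"] e by (simp add: R_def powr_mult mult_ac power2_eq_square)
  have "\<bar>\<integral>x. R x \<partial>\<mu>\<bar> \<le> (\<integral>x. \<bar>R x\<bar> \<partial>\<mu>)"
    by (rule integral_abs_bound)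
  also have "\<dots> \<le> (\<integral>x. C * e powr (2 + \<delta>) * norm x powr (2 + \<delta>) \<partial>\<mu>)"
    using Rle m iR by (intro integral_mono) auto
  finally show ?thesis
    by (simp add: R)
qed

text \<open>Jensen's inequality for y powr (1 + \<delta> / 2) with y the squared norm, whose mean is
  the dimension d: the power lies above its tangent at d, and the linear part of the tangent
  integrates to zero.\<close>

lemma norm_powr_moment_ge:
  assumes m: "integrable \<mu> (\<lambda>x. norm x powr (2 + \<delta>))" and \<delta>: "0 \<le> \<delta>"
  shows "DIM('a) powr (1 + \<delta> / 2) \<le> (\<integral>x. norm x powr (2 + \<delta>) \<partial>\<mu>)"
proof -
  define d where "d = real DIM('a)"
  have d: "0 < d" by (simp add: d_def)
  define a where "a = 1 + \<delta> / 2"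
  have tangent: "d powr a + a * d powr (a - 1) * (y - d) \<le> y powr a" if "0 \<le> y" for y
  proof (cases "y = 0")
    case True
    have "d powr a = d powr (a - 1) * d" using d by (simp add: powr_diff)
    then have "d powr a + a * d powr (a - 1) * (y - d) = (1 - a) * (d powr (a - 1) * d)"
      using True by (simp add: algebra_simps)
    also have "\<dots> \<le> 0"
      using \<delta> d by (intro mult_nonpos_nonneg) (auto simp: a_def)
    finally show ?thesis by (simp add: True)
  next
    case False
    then have y: "0 < y" using that by simp
    have a: "1 \<le> a" using \<delta> by (simp add: a_def)
    \<comment> \<open>Weighted arithmetic-geometric mean with weights 1 / a and 1 - 1 / a, which
      after multiplication by a is Bernoulli's inequality for y / d.\<close>
    have "((y / d) powr a) powr (1 / a) * 1 powr (1 - 1 / a) \<le> 1 / a * (y / d) powr a + (1 - 1 / a) * 1"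
      using y d a by (intro Youngs_inequality_0) auto
    then have "y / d \<le> 1 / a * (y / d) powr a + (1 - 1 / a)"
      using y d a by (simp add: powr_powr)
    then have "1 + a * (y / d - 1) \<le> (y / d) powr a"
      using mult_left_mono[of "y / d" "1 / a * (y / d) powr a + (1 - 1 / a)" a] a
      by (simp add: algebra_simps)
    then have "d powr a * (1 + a * (y / d - 1)) \<le> d powr a * (y / d) powr a"
      by (intro mult_left_mono) auto
    then show ?thesis
      using y d by (simp add: powr_divide powr_diff field_simps)
  qed
  have "d powr a = (\<integral>x. d powr a + a * d powr (a - 1) * ((norm x)\<^sup>2 - d) \<partial>\<mu>)"
    using integrable_norm_square by (simp add: integral_norm_square d_def)
  also have "\<dots> \<le> (\<integral>x. norm x powr (2 + \<delta>) \<partial>\<mu>)"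
  proof (rule integral_mono)
    show "d powr a + a * d powr (a - 1) * ((norm x)\<^sup>2 - d) \<le> norm x powr (2 + \<delta>)" for x
    proof -
      have "((norm x)\<^sup>2) powr a = norm x powr (2 + \<delta>)"
        by (cases "x = 0") (simp_all add: a_def powr_powr flip: powr_numeral)
      then show ?thesis using tangent[of "(norm x)\<^sup>2"] by simp
    qed
  qed (use integrable_norm_square m in auto)
  finally show ?thesis by (simp add: d_def a_def)
qed

end

section \<open>Gaussian moments and the cost of one swap\<close>

interpretation gauss: isotropic_measure "gauss :: 'a::euclidean_space measure"
proof -
  interpret prob_space "gauss :: 'a measure" by (rule prob_space_gauss)
  show "isotropic_measure (gauss :: 'a measure)"
  proof
    fix b c :: 'a
    assume b: "b \<in> Basis"
    show "(\<integral>x. x \<bullet> b \<partial>gauss) = 0"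
      by (rule gauss_integral_coord[OF b _ std_normal_moments(2)]) simp
    assume c: "c \<in> Basis"
    show "integrable gauss (\<lambda>x. (x \<bullet> b) * (x \<bullet> c))"
      "(\<integral>x. (x \<bullet> b) * (x \<bullet> c) \<partial>gauss) = (if b = c then 1 else 0)"
      using b c by (rule gauss_integrable_coord_prod, rule gauss_integral_coord_prod)
  qed (rule sets_gauss)
qed

lemma gauss_smooth_lipschitz: "1-lipschitz_on UNIV h \<Longrightarrow> 1-lipschitz_on UNIV (gauss_smooth \<sigma> h)"
  unfolding gauss_smooth_def [abs_def] by (rule gauss.lipschitz_integral_shift)

text \<open>Interpolation between the second moment d and a fourth moment of at most 3 times the
  square of d, with weights 1 - \<delta> / 2 and \<delta> / 2; these combine to the factor 1 +
  \<delta>.\<close>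

lemma
  assumes \<delta>: "0 \<le> \<delta>" "\<delta> \<le> 2"
  shows integrable_gauss_norm_powr:
      "integrable gauss (\<lambda>z::'a::euclidean_space. norm z powr (2 + \<delta>))"
    and gauss_norm_powr_le:
      "(\<integral>z. norm (z::'a) powr (2 + \<delta>) \<partial>gauss) \<le> (1 + \<delta>) * DIM('a) powr (1 + \<delta> / 2)"
proof -
  define d where "d = real DIM('a)"
  have d: "0 < d" by (simp add: d_def)
  have i4: "integrable gauss (\<lambda>z::'a. (z \<bullet> b) ^ 4)" and e4: "(\<integral>z. (z \<bullet> b) ^ 4 \<partial>(gauss :: 'a measure)) = 3"
    if "b \<in> Basis" for b
    using gauss_integrable_coord[OF that, of "\<lambda>x. x ^ 4"] gauss_integral_coord[OF that, of "\<lambda>x. x ^ 4"]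
      std_normal_moments(4) by auto
  \<comment> \<open>Cauchy-Schwarz over the coordinates reduces the fourth power of the norm to pure
    fourth powers, so mixed fourth moments do not arise.\<close>
  have n4: "norm z ^ 4 \<le> d * (\<Sum>b\<in>Basis. (z \<bullet> b) ^ 4)" for z :: 'a
  proof -
    have "(norm z)\<^sup>2 = (\<Sum>b\<in>Basis. (z \<bullet> b)\<^sup>2)"
      unfolding power2_norm_eq_inner by (subst euclidean_inner) (simp add: power2_eq_square)
    then have "norm z ^ 4 = (\<Sum>b\<in>Basis. (z \<bullet> b)\<^sup>2)\<^sup>2"
      by (metis power2_eq_square power4_eq_xxxx mult.assoc)
    also have "\<dots> \<le> (\<Sum>b\<in>(Basis::'a set). 1\<^sup>2) * (\<Sum>b\<in>Basis. ((z \<bullet> b)\<^sup>2)\<^sup>2)"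
      using Cauchy_Schwarz_ineq_sum[of "\<lambda>_. 1" "\<lambda>b. (z \<bullet> b)\<^sup>2" Basis] by simp
    finally show ?thesis by (simp add: d_def flip: power_mult)
  qed
  have i4_sum: "integrable gauss (\<lambda>z::'a. \<Sum>b\<in>Basis. (z \<bullet> b) ^ 4)"
    by (intro Bochner_Integration.integrable_sum i4)
  have e4_sum: "(\<integral>z. (\<Sum>b\<in>Basis. (z \<bullet> b) ^ 4) \<partial>(gauss :: 'a measure)) = 3 * d"
    by (subst Bochner_Integration.integral_sum) (simp_all add: i4 e4 d_def)
  define w where "w z = (1 - \<delta> / 2) * d powr (\<delta> / 2) * (norm z)\<^sup>2
      + \<delta> / 2 * d powr (\<delta> / 2 - 1) * (d * (\<Sum>b\<in>Basis. (z \<bullet> b) ^ 4))" for z :: 'a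
  have iw: "integrable gauss w"
    unfolding w_def using gauss.integrable_norm_square i4_sum by auto
  have le: "norm z powr (2 + \<delta>) \<le> w z" for z
  proof (cases "z = 0")
    case False
    define n where "n = norm z"
    have n: "0 < n" using False by (simp add: n_def)
    have "(n\<^sup>2 / d) powr (\<delta> / 2) * 1 powr (1 - \<delta> / 2) \<le> \<delta> / 2 * (n\<^sup>2 / d) + (1 - \<delta> / 2) * 1"
      using n d \<delta> by (intro Youngs_inequality_0) auto
    then have "(n\<^sup>2 / d) powr (\<delta> / 2) \<le> \<delta> / 2 * (n\<^sup>2 / d) + (1 - \<delta> / 2)"
      by simp
    then have "n\<^sup>2 * d powr (\<delta> / 2) * (n\<^sup>2 / d) powr (\<delta> / 2)
        \<le> n\<^sup>2 * d powr (\<delta> / 2) * (\<delta> / 2 * (n\<^sup>2 / d) + (1 - \<delta> / 2))"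
      by (intro mult_left_mono) auto
    also have "n\<^sup>2 * d powr (\<delta> / 2) * (n\<^sup>2 / d) powr (\<delta> / 2) = n powr (2 + \<delta>)"
      using n d by (simp add: powr_divide powr_powr powr_add flip: powr_numeral)
    also have "n\<^sup>2 * d powr (\<delta> / 2) * (\<delta> / 2 * (n\<^sup>2 / d) + (1 - \<delta> / 2))
        = (1 - \<delta> / 2) * d powr (\<delta> / 2) * n\<^sup>2 + \<delta> / 2 * d powr (\<delta> / 2 - 1) * n ^ 4"
      using d by (simp add: powr_diff[of d "\<delta> / 2" 1] algebra_simps power2_eq_square power4_eq_xxxx)
    also have "\<dots> \<le> w z"
      using n4[of z] \<delta> unfolding w_def n_def by (intro add_left_mono mult_left_mono) auto
    finally show ?thesis by (simp add: n_def)
  qed (use \<delta> in \<open>simp add: w_def sum_nonneg\<close>)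
  show i: "integrable gauss (\<lambda>z::'a. norm z powr (2 + \<delta>))"
    by (rule Bochner_Integration.integrable_bound[OF iw]) (auto intro!: AE_I2 order_trans[OF le])
  have "(\<integral>z. norm (z::'a) powr (2 + \<delta>) \<partial>gauss) \<le> (\<integral>z. w z \<partial>gauss)"
    using i iw le by (rule integral_mono)
  also have "\<dots> = (1 - \<delta> / 2) * d powr (\<delta> / 2) * d + \<delta> / 2 * d powr (\<delta> / 2 - 1) * (d * (3 * d))"
    unfolding w_def using gauss.integrable_norm_square[where 'a='a] i4_sum
    by (simp add: gauss.integral_norm_square e4_sum d_def)
  also have "\<dots> = (1 + \<delta>) * d powr (1 + \<delta> / 2)"
    using d by (simp add: powr_diff[of d "\<delta> / 2" 1] powr_add[of d 1 "\<delta> / 2"] algebra_simps)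
  finally show "(\<integral>z. norm (z::'a) powr (2 + \<delta>) \<partial>gauss) \<le> (1 + \<delta>) * DIM('a) powr (1 + \<delta> / 2)"
    by (simp add: d_def)
qed

text \<open>Both integrals have the same second-order part, leaving two remainders. By the two
  moment bounds the Gaussian moment is at most 1 + \<delta> times that of \<mu>, whence the factor 2
  + \<delta> on a single moment.\<close>

lemma (in isotropic_measure) gauss_smooth_step:
  assumes h: "1-lipschitz_on UNIV h" and \<sigma>: "0 < \<sigma>" and e: "0 < e" and \<delta>: "0 \<le> \<delta>" "\<delta> \<le> 1"
    and m: "integrable \<mu> (\<lambda>x. norm x powr (2 + \<delta>))"
  shows "\<bar>(\<integral>x. gauss_smooth \<sigma> h (t + e *\<^sub>R x) \<partial>\<mu>) - (\<integral>z. gauss_smooth \<sigma> h (t + e *\<^sub>R z) \<partial>gauss)\<bar>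
    \<le> (2 + \<delta>) / 3 powr \<delta> * (e powr (2 + \<delta>) / \<sigma> powr (1 + \<delta>)) * (\<integral>x. norm x powr (2 + \<delta>) \<partial>\<mu>)"
proof -
  define C where "C = 1 / (3 powr \<delta> * \<sigma> powr (1 + \<delta>))"
  obtain l q where
    b': "\<And>x \<delta>. 0 \<le> \<delta> \<Longrightarrow> \<delta> \<le> 1 \<Longrightarrow>
      \<bar>gauss_smooth \<sigma> h (t + x) - gauss_smooth \<sigma> h t - (\<Sum>b\<in>Basis. l b * (x \<bullet> b))
        - (\<Sum>b\<in>Basis. \<Sum>c\<in>Basis. q b c * ((x \<bullet> b) * (x \<bullet> c)))\<bar>
      \<le> norm x powr (2 + \<delta>) / (3 powr \<delta> * \<sigma> powr (1 + \<delta>))"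
    by (rule gauss_smooth_expansion_powr[OF h \<sigma>, of t]) blast
  have b: "\<bar>gauss_smooth \<sigma> h (t + x) - gauss_smooth \<sigma> h t - (\<Sum>b\<in>Basis. l b * (x \<bullet> b))
        - (\<Sum>b\<in>Basis. \<Sum>c\<in>Basis. q b c * ((x \<bullet> b) * (x \<bullet> c)))\<bar> \<le> C * norm x powr (2 + \<delta>)" for x
    using b'[OF \<delta>, of x] by (simp add: C_def)
  note g = gauss_smooth_lipschitz[OF h, of \<sigma>]
  let ?m = "\<integral>x. norm x powr (2 + \<delta>) \<partial>\<mu>" and ?mg = "\<integral>z. norm (z::'a) powr (2 + \<delta>) \<partial>gauss"
  have "?mg \<le> (1 + \<delta>) * ?m"
    using \<delta> norm_powr_moment_ge[OF m] gauss_norm_powr_le[of \<delta>]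
    by (intro order_trans[OF gauss_norm_powr_le] mult_left_mono) auto
  then have "C * e powr (2 + \<delta>) * (?m + ?mg) \<le> C * e powr (2 + \<delta>) * ((2 + \<delta>) * ?m)"
    using \<sigma> by (intro mult_left_mono) (auto simp: C_def algebra_simps)
  moreover have "\<bar>(\<integral>x. gauss_smooth \<sigma> h (t + e *\<^sub>R x) \<partial>\<mu>) - (\<integral>z. gauss_smooth \<sigma> h (t + e *\<^sub>R z) \<partial>gauss)\<bar>
    \<le> C * e powr (2 + \<delta>) * (?m + ?mg)"
    using integral_remainder_le[OF b g m e]
      gauss.integral_remainder_le[OF b g integrable_gauss_norm_powr e] \<delta>
    by (simp add: distrib_left)
  ultimately show ?thesis
    by (simp add: C_def mult_ac)
qed

section \<open>Swapping the summands one at a time\<close>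

lemma lborel_integral_affine:
  fixes f :: "'a::euclidean_space \<Rightarrow> real"
  assumes [measurable]: "f \<in> borel_measurable borel" and c: "c \<noteq> 0"
  shows "(\<integral>z. f z \<partial>lborel) = \<bar>c\<bar> ^ DIM('a) * (\<integral>z. f (t + c *\<^sub>R z) \<partial>lborel)"
  by (subst lborel_affine[OF c, of t]) (simp add: integral_density integral_distr)

text \<open>Rotation invariance of the two-fold product of the Gaussian density.\<close>

lemma gauss_density_rotate:
  fixes w z :: "'a::euclidean_space"
  assumes \<sigma>: "0 < \<sigma>" and \<tau>: "\<tau>\<^sup>2 = \<sigma>\<^sup>2 + e\<^sup>2"
  shows "gauss_density z * gauss_density ((1 / \<sigma>) *\<^sub>R (\<tau> *\<^sub>R w - e *\<^sub>R z))
    = gauss_density w * gauss_density ((1 / \<sigma>) *\<^sub>R (\<tau> *\<^sub>R z - e *\<^sub>R w))"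
proof -
  have n: "(norm ((1 / \<sigma>) *\<^sub>R (\<tau> *\<^sub>R x - e *\<^sub>R y)))\<^sup>2
      = (\<tau>\<^sup>2 * (norm x)\<^sup>2 - 2 * \<tau> * e * (x \<bullet> y) + e\<^sup>2 * (norm y)\<^sup>2) / \<sigma>\<^sup>2" for x y :: 'a
    unfolding power2_norm_eq_inner
    by (simp add: inner_diff inner_commute power2_eq_square algebra_simps add_divide_distrib diff_divide_distrib)
  have "(norm z)\<^sup>2 + (norm ((1 / \<sigma>) *\<^sub>R (\<tau> *\<^sub>R w - e *\<^sub>R z)))\<^sup>2
    = (norm w)\<^sup>2 + (norm ((1 / \<sigma>) *\<^sub>R (\<tau> *\<^sub>R z - e *\<^sub>R w)))\<^sup>2"
    unfolding n \<tau> using \<sigma> by (simp add: inner_commute field_simps)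
  then show ?thesis
    unfolding gauss_density_eq by (simp add: algebra_simps add_divide_distrib flip: exp_add)
qed

text \<open>The semigroup property: independent Gaussians add in variance. After an affine
  substitution and a rotation of the joint density, the combined Gaussian is separated from a kernel
  of total mass one.\<close>

lemma gauss_smooth_gauss:
  fixes h :: "'a::euclidean_space \<Rightarrow> real"
  assumes h: "1-lipschitz_on UNIV h" and \<sigma>: "0 < \<sigma>" and \<tau>: "0 < \<tau>" "\<tau>\<^sup>2 = \<sigma>\<^sup>2 + e\<^sup>2"
  shows "(\<integral>z. gauss_smooth \<sigma> h (t + e *\<^sub>R z) \<partial>gauss) = gauss_smooth \<tau> h t"
proof -
  note [measurable] = lipschitz_borel_measurable[OF h] lipschitz_borel_measurable[OF gauss_smooth_lipschitz[OF h]]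
  define c where "c = \<tau> / \<sigma>"
  have c: "0 < c" using \<sigma> \<tau> by (simp add: c_def)
  \<comment> \<open>For fixed w this is the conditional density of z given the normalized sum w: a
    Gaussian with mean e w / \<tau> and standard deviation \<sigma> / \<tau> in each
    coordinate.\<close>
  define k where "k w z = c ^ DIM('a) * gauss_density ((1 / \<sigma>) *\<^sub>R (\<tau> *\<^sub>R z - e *\<^sub>R w))" for w z :: 'a
  define F where "F p = gauss_density (fst p) * h (t + \<tau> *\<^sub>R fst p) * k (fst p) (snd p)" for p
  have [measurable]: "F \<in> borel_measurable (lborel \<Otimes>\<^sub>M lborel)"
    unfolding F_def k_def by measurable
  have g1: "(\<integral>z. gauss_density (z :: 'a) \<partial>lborel) = 1" "integrable lborel (gauss_density :: 'a \<Rightarrow> real)"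
    using integral_gauss_eq[of "\<lambda>_::'a. 1"] integrable_gauss_iff[of "\<lambda>_::'a. 1"] by simp_all
  have ek: "k w z = c ^ DIM('a) * gauss_density (- ((e / \<sigma>) *\<^sub>R w) + c *\<^sub>R z)" for w z
    using \<sigma> \<tau> by (simp add: k_def c_def scaleR_diff_right)
  have k1: "(\<integral>z. k w z \<partial>lborel) = 1" for w
    using lborel_integral_affine[of gauss_density c "- ((e / \<sigma>) *\<^sub>R w)"] c g1
    by (simp add: ek del: uminus_add_conv_diff)
  \<comment> \<open>A non-integrable function has Bochner integral 0, so an integral equal to 1
    already implies integrability.\<close>
  have ki: "integrable lborel (k w)" for w
    using k1[of w] not_integrable_integral_eq by fastforce
  have k0: "0 \<le> k w z" for w z
    using c by (simp add: k_def)
  have ih: "integrable lborel (\<lambda>w. gauss_density w * h (t + \<tau> *\<^sub>R w))"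
    using gauss.integrable_lipschitz[OF h, of t \<tau>] by (subst (asm) integrable_gauss_iff) auto
  have iF: "integrable (lborel \<Otimes>\<^sub>M lborel) F"
  proof (rule lborel_pair.Fubini_integrable)
    show "AE w in lborel. integrable lborel (\<lambda>z. F (w, z))"
      by (simp add: F_def ki)
    have "(\<integral>z. norm (F (w, z)) \<partial>lborel) = \<bar>gauss_density w * h (t + \<tau> *\<^sub>R w)\<bar>" for w
      using k0 by (simp add: F_def abs_mult k1)
    then show "integrable lborel (\<lambda>w. \<integral>z. norm (F (w, z)) \<partial>lborel)"
      using ih by simp
  qed measurable
  have "(\<integral>z. gauss_smooth \<sigma> h (t + e *\<^sub>R z) \<partial>gauss)
      = (\<integral>z. gauss_density z * (\<integral>w. gauss_density w * h (t + e *\<^sub>R z + \<sigma> *\<^sub>R w) \<partial>lborel) \<partial>lborel)"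
    by (subst integral_gauss_eq) (simp_all add: gauss_smooth_def integral_gauss_eq)
  also have "\<dots> = (\<integral>z. (\<integral>w. F (w, z) \<partial>lborel) \<partial>lborel)"
  proof (intro Bochner_Integration.integral_cong refl)
    fix z :: 'a
    have "(\<integral>w. gauss_density w * h (t + e *\<^sub>R z + \<sigma> *\<^sub>R w) \<partial>lborel)
        = c ^ DIM('a) * (\<integral>w. gauss_density ((1 / \<sigma>) *\<^sub>R (\<tau> *\<^sub>R w - e *\<^sub>R z)) * h (t + \<tau> *\<^sub>R w) \<partial>lborel)"
      using \<sigma> \<tau>(1)
      by (subst lborel_integral_affine[of _ c "- ((e / \<sigma>) *\<^sub>R z)"])
        (simp_all add: c_def scaleR_diff_right scaleR_add_right)
    moreover have F_eq: "F (w, z) = gauss_density z * (c ^ DIM('a)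
        * (gauss_density ((1 / \<sigma>) *\<^sub>R (\<tau> *\<^sub>R w - e *\<^sub>R z)) * h (t + \<tau> *\<^sub>R w)))" for w
    proof -
      have "F (w, z) = c ^ DIM('a) * h (t + \<tau> *\<^sub>R w)
          * (gauss_density w * gauss_density ((1 / \<sigma>) *\<^sub>R (\<tau> *\<^sub>R z - e *\<^sub>R w)))"
        by (simp add: F_def k_def)
      also have "gauss_density w * gauss_density ((1 / \<sigma>) *\<^sub>R (\<tau> *\<^sub>R z - e *\<^sub>R w))
          = gauss_density z * gauss_density ((1 / \<sigma>) *\<^sub>R (\<tau> *\<^sub>R w - e *\<^sub>R z))"
        by (rule gauss_density_rotate[OF \<sigma> \<tau>(2), symmetric])
      finally show ?thesis
        by (simp add: mult_ac)
    qed
    ultimately show "gauss_density z * (\<integral>w. gauss_density w * h (t + e *\<^sub>R z + \<sigma> *\<^sub>R w) \<partial>lborel)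
        = (\<integral>w. F (w, z) \<partial>lborel)"
      by (simp add: F_eq mult.assoc)
  qed
  also have "\<dots> = (\<integral>w. (\<integral>z. F (w, z) \<partial>lborel) \<partial>lborel)"
    using lborel_pair.Fubini_integral[of "\<lambda>w z. F (w, z)"] iF by simp
  also have "\<dots> = (\<integral>w. gauss_density w * h (t + \<tau> *\<^sub>R w) \<partial>lborel)"
    by (simp add: F_def k1)
  also have "\<dots> = gauss_smooth \<tau> h t"
    by (simp add: gauss_smooth_def integral_gauss_eq)
  finally show ?thesis .
qed

text \<open>By induction, each term is at most the increment of n powr (1 - b) / (1 - b).\<close>

lemma sum_powr_le:
  assumes b: "0 < b" "b < 1"
  shows "(\<Sum>j=1..n. real j powr (- b)) \<le> real n powr (1 - b) / (1 - b)"
proof (induction n)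
  case (Suc n)
  have "real (Suc n) powr (- b) \<le> (real (Suc n) powr (1 - b) - real n powr (1 - b)) / (1 - b)"
  proof -
    define y where "y = real (Suc n)"
    have y: "1 \<le> y" "real n = y - 1" by (simp_all add: y_def)
    \<comment> \<open>weighted AM-GM replaces the comparison of the sum with an integral\<close>
    have "(y - 1) powr (1 - b) * y powr b \<le> (1 - b) * (y - 1) + b * y"
    proof (cases "y = 1")
      case False
      then show ?thesis using b y by (intro Youngs_inequality_0) auto
    qed (use b in auto)
    then have "(y - 1) powr (1 - b) * y powr b \<le> y - (1 - b)"
      by (simp add: algebra_simps)
    then have "((y - 1) powr (1 - b) * y powr b) * y powr (- b) \<le> (y - (1 - b)) * y powr (- b)"
      by (intro mult_right_mono) auto
    moreover have "y powr b * y powr (- b) = 1" "y * y powr (- b) = y powr (1 - b)"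
      using y by (simp_all add: powr_minus powr_diff divide_inverse)
    ultimately have "(y - 1) powr (1 - b) \<le> y powr (1 - b) - (1 - b) * y powr (- b)"
      by (simp add: mult.assoc left_diff_distrib)
    then show ?thesis
      using b unfolding y_def[symmetric] y(2) by (simp add: le_divide_eq algebra_simps)
  qed
  then show ?case
    using Suc b by (simp add: diff_divide_distrib)
qed simp

section \<open>Splitting one summand off an independent sum\<close>

lemma (in prob_space) indep_var_sum_scaleR:
  fixes X :: "'i \<Rightarrow> 'a \<Rightarrow> 'b::euclidean_space"
  assumes I: "finite I" "i \<notin> I" and indep: "indep_vars (\<lambda>_. borel) X (insert i I)"
  shows "indep_var borel (\<lambda>\<omega>. c *\<^sub>R (\<Sum>j\<in>I. X j \<omega>)) borel (X i)"
proof -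
  have "indep_var
    borel ((\<lambda>f. c *\<^sub>R (\<Sum>j\<in>I. f j)) \<circ> (\<lambda>\<omega>. restrict (\<lambda>j. X j \<omega>) I))
    borel ((\<lambda>f. f i) \<circ> (\<lambda>\<omega>. restrict (\<lambda>j. X j \<omega>) {i}))"
    using I by (intro indep_var_compose[OF indep_var_restrict[OF indep]]) auto
  then show ?thesis
    by (simp add: o_def)
qed

text \<open>Independence makes the joint law of T and Y a product measure, and Fubini then
  integrates out Y with T held fixed.\<close>

lemma (in prob_space) indep_var_integral_shift:
  fixes T Y :: "'a \<Rightarrow> 'b::euclidean_space" and f :: "'b \<Rightarrow> real"
  assumes indep: "indep_var borel T borel Y" and [measurable]: "f \<in> borel_measurable borel"
    and int: "integrable M (\<lambda>\<omega>. f (T \<omega> + e *\<^sub>R Y \<omega>))"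
  shows "(\<integral>\<omega>. f (T \<omega> + e *\<^sub>R Y \<omega>) \<partial>M)
    = (\<integral>\<omega>. (\<integral>x. f (T \<omega> + e *\<^sub>R x) \<partial>(distr M borel Y)) \<partial>M)"
proof -
  have [measurable]: "T \<in> borel_measurable M" "Y \<in> borel_measurable M"
    using indep_var_rv1[OF indep] indep_var_rv2[OF indep] by auto
  interpret T: prob_space "distr M borel T" by (rule prob_space_distr) simp
  interpret Y: prob_space "distr M borel Y" by (rule prob_space_distr) simp
  interpret P: pair_sigma_finite "distr M borel T" "distr M borel Y" ..
  have eq: "distr M borel T \<Otimes>\<^sub>M distr M borel Y = distr M (borel \<Otimes>\<^sub>M borel) (\<lambda>\<omega>. (T \<omega>, Y \<omega>))"
    using indep by (simp add: indep_var_distribution_eq)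
  define g where "g p = f (fst p + e *\<^sub>R snd p)" for p
  have [measurable]: "g \<in> borel_measurable (borel \<Otimes>\<^sub>M borel)"
    unfolding g_def by measurable
  have ig: "integrable (distr M borel T \<Otimes>\<^sub>M distr M borel Y) g"
    unfolding eq using int by (subst integrable_distr_eq) (auto simp: g_def)
  have "(\<integral>\<omega>. f (T \<omega> + e *\<^sub>R Y \<omega>) \<partial>M) = integral\<^sup>L (distr M borel T \<Otimes>\<^sub>M distr M borel Y) g"
    unfolding eq by (subst integral_distr) (auto simp: g_def)
  also have "\<dots> = (\<integral>t. (\<integral>x. f (t + e *\<^sub>R x) \<partial>(distr M borel Y)) \<partial>(distr M borel T))"
    using P.integral_fst'[OF ig] by (simp add: g_def)
  also have "\<dots> = (\<integral>\<omega>. (\<integral>x. f (T \<omega> + e *\<^sub>R x) \<partial>(distr M borel Y)) \<partial>M)"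
    by (subst integral_distr) simp_all
  finally show ?thesis .
qed

lemma (in prob_space) lindeberg_swapping:
  fixes X :: "nat \<Rightarrow> 'a \<Rightarrow> 'b::euclidean_space" and h :: "'b \<Rightarrow> real"
  assumes indep: "indep_vars (\<lambda>_. borel) X {1..}"
    and law: "\<And>j. j \<ge> 1 \<Longrightarrow> distr M borel (X j) = \<mu>"
    and iso: "isotropic_measure \<mu>"
    and \<delta>: "0 < \<delta>" "\<delta> < 1" and m: "integrable \<mu> (\<lambda>x. norm x powr (2 + \<delta>))"
    and h: "1-lipschitz_on UNIV h" and n: "n \<ge> 1"
  shows "\<bar>(\<integral>\<omega>. h ((1 / sqrt n) *\<^sub>R (\<Sum>j=1..n. X j \<omega>)) \<partial>M) - (\<integral>z. h z \<partial>gauss)\<bar>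
    \<le> 1 / n powr (\<delta> / 2) * (2 / (1 - \<delta>) * ((2 + \<delta>) / 3 powr \<delta>) * (\<integral>x. norm x powr (2 + \<delta>) \<partial>\<mu>)
        + 2 * sqrt DIM('b))"
proof -
  interpret \<mu>: isotropic_measure \<mu> by (rule iso)
  define e where "e = 1 / sqrt n"
  have e: "0 < e" "e\<^sup>2 = 1 / n" using n by (simp_all add: e_def power_divide)
  \<comment> \<open>\<open>T k\<close> holds the first k original summands, and \<open>s k\<close>
    is the standard deviation, per coordinate, of the n - k Gaussian summands that stand in for the
    rest. Thus \<open>A n\<close> has only original summands and \<open>A 0\<close> only Gaussian
    ones.\<close>
  define T where "T k \<omega> = e *\<^sub>R (\<Sum>j=1..k. X j \<omega>)" for k \<omega>
  define s where "s k = sqrt (real (n - k) / n)" for k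
  define A where "A k = (\<integral>\<omega>. gauss_smooth (s k) h (T k \<omega>) \<partial>M)" for k
  define C where "C = (2 + \<delta>) / 3 powr \<delta> * (\<integral>x. norm x powr (2 + \<delta>) \<partial>\<mu>)"
  have Xm [measurable]: "X j \<in> borel_measurable M" if "j \<ge> 1" for j
    using indep that by (auto simp: indep_vars_def)
  have Tm [measurable]: "T k \<in> borel_measurable M" for k
    unfolding T_def by measurable
  have iX: "integrable M (\<lambda>\<omega>. norm (X j \<omega>))" if "j \<ge> 1" for j
    using \<mu>.integrable_norm that unfolding law[OF that, symmetric] by (subst (asm) integrable_distr_eq) auto
  have iT: "integrable M (\<lambda>\<omega>. f (T k \<omega>))" if f: "1-lipschitz_on UNIV f" for f :: "'b \<Rightarrow> real" and k
  proof (rule Bochner_Integration.integrable_bound)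
    note [measurable] = lipschitz_borel_measurable[OF f]
    show "(\<lambda>\<omega>. f (T k \<omega>)) \<in> borel_measurable M" by measurable
    show "integrable M (\<lambda>\<omega>. \<bar>f 0\<bar> + e * (\<Sum>j=1..k. norm (X j \<omega>)))"
      by (intro Bochner_Integration.integrable_add integrable_mult_right Bochner_Integration.integrable_sum iX) auto
    have "\<bar>f (T k \<omega>)\<bar> \<le> \<bar>f 0\<bar> + e * (\<Sum>j=1..k. norm (X j \<omega>))" for \<omega>
    proof -
      have "norm (T k \<omega>) \<le> e * (\<Sum>j=1..k. norm (X j \<omega>))"
        using e by (simp add: T_def norm_sum)
      then show ?thesis using lipschitz_abs_le[OF f, of "T k \<omega>" 0] by simp
    qed
    then show "AE \<omega> in M. norm (f (T k \<omega>)) \<le> norm (\<bar>f 0\<bar> + e * (\<Sum>j=1..k. norm (X j \<omega>)))"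
      by (auto intro!: AE_I2 order_trans[OF _ abs_ge_self])
  qed
  have step: "(\<integral>\<omega>. f (T (Suc k) \<omega>) \<partial>M) = (\<integral>\<omega>. (\<integral>x. f (T k \<omega> + e *\<^sub>R x) \<partial>\<mu>) \<partial>M)"
    if f: "1-lipschitz_on UNIV f" for f :: "'b \<Rightarrow> real" and k
  proof -
    note [measurable] = lipschitz_borel_measurable[OF f]
    have "indep_var borel (T k) borel (X (Suc k))"
      unfolding T_def by (intro indep_var_sum_scaleR indep_vars_subset[OF indep]) auto
    moreover have T_Suc: "T (Suc k) \<omega> = T k \<omega> + e *\<^sub>R X (Suc k) \<omega>" for \<omega>
      by (simp add: T_def scaleR_add_right)
    ultimately show ?thesis
      using indep_var_integral_shift[of "T k" "X (Suc k)" f e] iT[OF f, of "Suc k"] law[of "Suc k"]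
      by simp
  qed
  \<comment> \<open>A swap need only be estimated at a deterministic base point t, uniformly in t;
    this passes the bound to the random point \<open>T k\<close>.\<close>
  have diff_le: "\<bar>(\<integral>\<omega>. f (T k \<omega>) \<partial>M) - (\<integral>\<omega>. g (T k \<omega>) \<partial>M)\<bar> \<le> B"
    if fg: "1-lipschitz_on UNIV f" "1-lipschitz_on UNIV g" and B: "\<And>t. \<bar>f t - g t\<bar> \<le> B"
    for f g :: "'b \<Rightarrow> real" and k B
  proof -
    have "\<bar>(\<integral>\<omega>. f (T k \<omega>) \<partial>M) - (\<integral>\<omega>. g (T k \<omega>) \<partial>M)\<bar> = \<bar>\<integral>\<omega>. f (T k \<omega>) - g (T k \<omega>) \<partial>M\<bar>"
      using iT fg by simp
    also have "\<dots> \<le> (\<integral>\<omega>. \<bar>f (T k \<omega>) - g (T k \<omega>)\<bar> \<partial>M)"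
      by (rule integral_abs_bound)
    also have "\<dots> \<le> (\<integral>\<omega>. B \<partial>M)"
      using iT fg B by (intro integral_mono) auto
    finally show ?thesis by (simp add: prob_space)
  qed
  have s2: "(s k)\<^sup>2 = (s (Suc k))\<^sup>2 + e\<^sup>2" if "k < n" for k
    using that n by (simp add: s_def e power_divide of_nat_diff field_simps)
  \<comment> \<open>In \<open>A k\<close> one Gaussian summand is split off the smoothing, so both
    sides are integrals of the function smoothed at scale \<open>s (Suc k)\<close>. That scale is
    positive because Suc k < n.\<close>
  have swap: "\<bar>A (Suc k) - A k\<bar> \<le> C * (e powr (2 + \<delta>) / s (Suc k) powr (1 + \<delta>))" if k: "Suc k < n" for k
  proof -
    have s: "0 < s (Suc k)" "0 < s k" using k by (simp_all add: s_def)
    note G = gauss_smooth_lipschitz[OF h]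
    have "A k = (\<integral>\<omega>. (\<integral>z. gauss_smooth (s (Suc k)) h (T k \<omega> + e *\<^sub>R z) \<partial>gauss) \<partial>M)"
      using k s s2[of k] by (simp add: A_def gauss_smooth_gauss[OF h])
    moreover have "A (Suc k) = (\<integral>\<omega>. (\<integral>x. gauss_smooth (s (Suc k)) h (T k \<omega> + e *\<^sub>R x) \<partial>\<mu>) \<partial>M)"
      unfolding A_def by (rule step[OF G])
    moreover have "\<bar>(\<integral>\<omega>. (\<integral>x. gauss_smooth (s (Suc k)) h (T k \<omega> + e *\<^sub>R x) \<partial>\<mu>) \<partial>M)
       - (\<integral>\<omega>. (\<integral>z. gauss_smooth (s (Suc k)) h (T k \<omega> + e *\<^sub>R z) \<partial>gauss) \<partial>M)\<bar>
      \<le> C * (e powr (2 + \<delta>) / s (Suc k) powr (1 + \<delta>))"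
      using \<mu>.gauss_smooth_step[OF h s(1) e(1) _ _ m] \<delta>
      by (intro diff_le \<mu>.lipschitz_integral_shift gauss.lipschitz_integral_shift G)
        (simp add: C_def mult_ac)
    ultimately show ?thesis by simp
  qed
  \<comment> \<open>Here the scale \<open>s n\<close> is 0. Both integrals are compared with h t,
    each at cost e times the square root of the dimension.\<close>
  have last: "\<bar>A n - A (n - 1)\<bar> \<le> 2 * sqrt DIM('b) * e"
  proof -
    have s0: "s n = 0" and s1: "s (n - 1) = e"
      using n by (simp_all add: s_def e_def real_sqrt_divide)
    have n1: "Suc (n - 1) = n" using n by simp
    have "A n = (\<integral>\<omega>. (\<integral>x. h (T (n - 1) \<omega> + e *\<^sub>R x) \<partial>\<mu>) \<partial>M)"
      using step[OF h, of "n - 1"] unfolding A_def s0 n1 by (simp add: gauss_smooth_def)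
    moreover have "A (n - 1) = (\<integral>\<omega>. (\<integral>z. h (T (n - 1) \<omega> + e *\<^sub>R z) \<partial>gauss) \<partial>M)"
      unfolding A_def s1 gauss_smooth_def ..
    moreover have "\<bar>(\<integral>\<omega>. (\<integral>x. h (T (n - 1) \<omega> + e *\<^sub>R x) \<partial>\<mu>) \<partial>M)
        - (\<integral>\<omega>. (\<integral>z. h (T (n - 1) \<omega> + e *\<^sub>R z) \<partial>gauss) \<partial>M)\<bar> \<le> 2 * sqrt DIM('b) * e"
    proof (intro diff_le \<mu>.lipschitz_integral_shift gauss.lipschitz_integral_shift h)
      fix t
      show "\<bar>(\<integral>x. h (t + e *\<^sub>R x) \<partial>\<mu>) - (\<integral>z. h (t + e *\<^sub>R z) \<partial>gauss)\<bar> \<le> 2 * sqrt DIM('b) * e"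
        using \<mu>.integral_shift_diff_le[OF h, of t e] gauss.integral_shift_diff_le[OF h, of t e] e(1)
        by (simp add: mult_ac)
    qed
    ultimately show ?thesis by simp
  qed
  \<comment> \<open>With b = (1 + \<delta>) / 2 and j = n - Suc k, the powers of n combine so that
    each term equals n powr (-1/2) * j powr (-b). Since b < 1 the sum over j grows like n powr (1 -
    b), and 1 - b = (1 - \<delta>) / 2 is the source of 2 / (1 - \<delta>).\<close>
  have sum_le: "(\<Sum>k<n - 1. e powr (2 + \<delta>) / s (Suc k) powr (1 + \<delta>)) \<le> 2 / (1 - \<delta>) / n powr (\<delta> / 2)"
  proof -
    define b where "b = (1 + \<delta>) / 2"
    have b: "0 < b" "b < 1" using \<delta> by (simp_all add: b_def)
    have e_powr: "e powr (2 + \<delta>) = real n powr (- (1 + \<delta> / 2))"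
    proof -
      have "e = real n powr (- 1 / 2)"
        by (simp add: e_def powr_minus_divide powr_half_sqrt)
      then show ?thesis
        by (simp add: powr_powr add_divide_distrib)
    qed
    have t: "e powr (2 + \<delta>) / s (Suc k) powr (1 + \<delta>) = real n powr (- 1 / 2) * real (n - Suc k) powr (- b)"
      if "k < n - 1" for k
    proof -
      have "s (Suc k) powr (1 + \<delta>) = real (n - Suc k) powr b / real n powr b"
        by (simp add: s_def b_def powr_divide powr_powr flip: powr_half_sqrt)
      then have "e powr (2 + \<delta>) / s (Suc k) powr (1 + \<delta>)
          = (real n powr (- (1 + \<delta> / 2)) * real n powr b) * real (n - Suc k) powr (- b)"
        by (simp add: e_powr powr_minus_divide)
      also have "real n powr (- (1 + \<delta> / 2)) * real n powr b = real n powr (- 1 / 2)"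
        by (simp add: b_def add_divide_distrib flip: powr_add)
      finally show ?thesis .
    qed
    have "(\<Sum>k<n - 1. e powr (2 + \<delta>) / s (Suc k) powr (1 + \<delta>))
        = (\<Sum>k<n - 1. real n powr (- 1 / 2) * real (n - Suc k) powr (- b))"
      by (intro sum.cong refl t) simp
    also have "\<dots> = real n powr (- 1 / 2) * (\<Sum>k<n - 1. real (n - Suc k) powr (- b))"
      by (simp add: sum_distrib_left)
    also have "(\<Sum>k<n - 1. real (n - Suc k) powr (- b)) = (\<Sum>j=1..n - 1. real j powr (- b))"
      by (rule sum.reindex_bij_witness[of _ "\<lambda>j. n - Suc j" "\<lambda>k. n - Suc k"]) auto
    also have "real n powr (- 1 / 2) * (\<Sum>j=1..n - 1. real j powr (- b))
        \<le> real n powr (- 1 / 2) * (real n powr (1 - b) / (1 - b))"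
    proof (rule mult_left_mono)
      have "(\<Sum>j=1..n - 1. real j powr (- b)) \<le> real (n - 1) powr (1 - b) / (1 - b)"
        by (rule sum_powr_le[OF b])
      also have "\<dots> \<le> real n powr (1 - b) / (1 - b)"
        using b by (intro divide_right_mono powr_mono2) auto
      finally show "(\<Sum>j=1..n - 1. real j powr (- b)) \<le> real n powr (1 - b) / (1 - b)" .
    qed simp
    also have "\<dots> = real n powr (- 1 / 2 + (1 - b)) / (1 - b)"
      by (simp only: powr_add times_divide_eq_right)
    also have "- 1 / 2 + (1 - b) = - (\<delta> / 2)" by (simp add: b_def field_simps)
    also have "1 - b = (1 - \<delta>) / 2" by (simp add: b_def field_simps)
    finally show ?thesis by (simp add: powr_minus_divide mult.commute)
  qed
  have C: "0 \<le> C" using \<delta> by (simp add: C_def)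
  have "\<bar>A n - A 0\<bar> \<le> \<bar>A n - A (n - 1)\<bar> + \<bar>A (n - 1) - A 0\<bar>"
    by simp
  also have "A (n - 1) - A 0 = (\<Sum>k<n - 1. A (Suc k) - A k)"
    by (simp add: sum_lessThan_telescope)
  also have "\<bar>A n - A (n - 1)\<bar> + \<bar>\<Sum>k<n - 1. A (Suc k) - A k\<bar>
      \<le> 2 * sqrt DIM('b) * e + (\<Sum>k<n - 1. C * (e powr (2 + \<delta>) / s (Suc k) powr (1 + \<delta>)))"
    using swap by (intro add_mono last order_trans[OF sum_abs] sum_mono) auto
  also have "\<dots> \<le> 2 * sqrt DIM('b) * (1 / n powr (\<delta> / 2)) + C * (2 / (1 - \<delta>) / n powr (\<delta> / 2))"
  proof -
    have "n powr (\<delta> / 2) \<le> n powr (1 / 2)"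
      using n \<delta> by (intro powr_mono) auto
    then have "e \<le> 1 / n powr (\<delta> / 2)"
      using n by (simp add: e_def powr_half_sqrt divide_simps)
    then show ?thesis
      unfolding sum_distrib_left[symmetric] using sum_le C by (intro add_mono mult_left_mono) auto
  qed
  also have "A n = (\<integral>\<omega>. h ((1 / sqrt n) *\<^sub>R (\<Sum>j=1..n. X j \<omega>)) \<partial>M)"
    by (simp add: A_def s_def gauss_smooth_def T_def e_def)
  also have "A 0 = (\<integral>z. h z \<partial>gauss)"
    using n by (simp add: A_def s_def gauss_smooth_def T_def prob_space)
  finally have "\<bar>(\<integral>\<omega>. h ((1 / sqrt n) *\<^sub>R (\<Sum>j=1..n. X j \<omega>)) \<partial>M) - (\<integral>z. h z \<partial>gauss)\<bar>
    \<le> 2 * sqrt DIM('b) * (1 / n powr (\<delta> / 2)) + C * (2 / (1 - \<delta>) / n powr (\<delta> / 2))" .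
  moreover have "x * (1 / y) + (a * r) * (b / y) = 1 / y * (b * a * r + x)" for a b r x y :: real
    by (simp add: algebra_simps add_divide_distrib)
  ultimately show ?thesis
    by (simp only: C_def)
qed

section \<open>The constants\<close>

lemma Gamma_plus1_pos: "0 < x \<Longrightarrow> Gamma (x + 1) = x * Gamma x" for x :: real
  by (intro Gamma_plus1) (auto elim!: nonpos_Ints_cases)

lemma Gamma_half_ratio_plus2:
  fixes x :: real
  assumes "0 < x"
  shows "Gamma ((1 + (x + 2)) / 2) / Gamma ((x + 2) / 2) = (1 + x) / x * (Gamma ((1 + x) / 2) / Gamma (x / 2))"
proof -
  have "(1 + (x + 2)) / 2 = (1 + x) / 2 + 1" "(x + 2) / 2 = x / 2 + 1"
    by (simp_all add: field_simps)
  moreover have "Gamma ((1 + x) / 2 + 1) = (1 + x) / 2 * Gamma ((1 + x) / 2)"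
      "Gamma (x / 2 + 1) = x / 2 * Gamma (x / 2)"
    using assms by (intro Gamma_plus1_pos; simp)+
  ultimately show ?thesis by (simp only: times_divide_times_eq) simp
qed

text \<open>Raising the dimension by two multiplies the ratio by a factor above 1, so the base
  dimensions 2 and 3 suffice. The offset excludes dimension 1, where the ratio 1 / sqrt pi lies
  below the bound.\<close>

lemma Gamma_half_ratio_ge:
  "sqrt pi / 2 \<le> Gamma ((1 + real (n + 2)) / 2) / Gamma (real (n + 2) / 2)"
proof (induction n rule: nat_less_induct)
  case (1 n)
  have half: "Gamma (3 / 2 :: real) = sqrt pi / 2"
    using Gamma_plus1_pos[of "1 / 2"] Gamma_one_half_real by simp
  consider "n = 0" | "n = 1" | k where "n = k + 2"
    by (metis One_nat_def add_2_eq_Suc' not0_implies_Suc)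
  then show ?case
  proof cases
    case 1
    then show ?thesis by (simp add: half)
  next
    case 2
    have "sqrt pi / 2 \<le> 2 / sqrt pi"
      using pi_less_4 by (simp add: field_simps)
    then show ?thesis
      using Gamma_half_ratio_plus2[of 1] 2 by (simp add: Gamma_one_half_real)
  next
    case (3 k)
    define r where "r = Gamma ((1 + real (k + 2)) / 2) / Gamma (real (k + 2) / 2)"
    have r: "sqrt pi / 2 \<le> r"
      using 1 3 by (auto simp: r_def)
    have "1 * r \<le> (1 + real (k + 2)) / real (k + 2) * r"
      using r by (intro mult_right_mono) (auto intro: order_trans[OF _ r])
    also have "\<dots> = Gamma ((1 + real (n + 2)) / 2) / Gamma (real (n + 2) / 2)"
      using Gamma_half_ratio_plus2[of "real (k + 2)"] 3 by (simp add: r_def)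
    finally show ?thesis using r by linarith
  qed
qed

text \<open>In dimension 1 the claim comes down to 2 * pi \<le> 9. In higher dimensions (2 d + 1) /
  d is at least 2, and the lower bound on the Gamma ratio gives the rest.\<close>

lemma K1_ge_4:
  assumes "d \<ge> 1"
  shows "4 \<le> K1 d"
proof -
  define r where "r = Gamma ((1 + real d) / 2) / Gamma (real d / 2)"
  have "sqrt 2 \<le> (2 * real d + 1) / real d * r"
  proof (cases "d = 1")
    case True
    have "sqrt 2 * sqrt pi \<le> 3"
      using pi_less_4 by (simp add: real_le_lsqrt flip: real_sqrt_mult)
    then show ?thesis
      using True by (simp add: r_def Gamma_one_half_real field_simps)
  next
    case False
    then have r: "sqrt pi / 2 \<le> r"
      using Gamma_half_ratio_ge[of "d - 2"] assms by (simp add: r_def of_nat_diff)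
    have "sqrt 2 \<le> sqrt pi"
      using pi_ge_two by simp
    also have "\<dots> = 2 * (sqrt pi / 2)"
      by simp
    also have "\<dots> \<le> (2 * real d + 1) / real d * r"
      using assms r by (intro mult_mono) (auto simp: field_simps)
    finally show ?thesis .
  qed
  then have "2 powr (3 / 2) * sqrt 2 \<le> 2 powr (3 / 2) * ((2 * real d + 1) / real d * r)"
    by (intro mult_left_mono) auto
  also have "2 powr (3 / 2) * sqrt 2 = (4 :: real)"
    by (simp flip: powr_half_sqrt powr_add)
  finally show ?thesis
    by (simp add: K1_def r_def mult.assoc)
qed

text \<open>Equality holds at both endpoints, and the logarithm of the quotient is concave.\<close>

lemma two_plus_le_powr:
  fixes \<delta> :: real
  assumes \<delta>: "0 \<le> \<delta>" "\<delta> \<le> 1"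
  shows "2 + \<delta> \<le> (2 - \<delta>) * 3 powr \<delta>"
proof -
  define g where "g x = ln (2 + x) - ln (2 - x) - x * ln 3" for x :: real
  have "convex_on {0..1} g"
  proof (rule f''_ge0_imp_convex)
    fix x :: real assume x: "x \<in> {0..1}"
    show "(g has_real_derivative 1 / (2 + x) + 1 / (2 - x) - ln 3) (at x)"
      unfolding g_def using x by (auto intro!: derivative_eq_intros)
    show "((\<lambda>x. 1 / (2 + x) + 1 / (2 - x) - ln 3) has_real_derivative
        1 / (2 - x)\<^sup>2 - 1 / (2 + x)\<^sup>2) (at x)"
      using x by (auto intro!: derivative_eq_intros simp: power2_eq_square)
    show "0 \<le> 1 / (2 - x)\<^sup>2 - 1 / (2 + x)\<^sup>2"
      using x by (simp add: frac_le power_mono)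
  qed simp
  then have "g ((1 - \<delta>) *\<^sub>R 0 + \<delta> *\<^sub>R 1) \<le> (1 - \<delta>) * g 0 + \<delta> * g 1"
    using \<delta> by (intro convex_onD) auto
  then have "ln (2 + \<delta>) \<le> ln ((2 - \<delta>) * 3 powr \<delta>)"
    using \<delta> by (simp add: g_def ln_mult ln_powr)
  then show ?thesis
    using \<delta> by (subst (asm) ln_le_cancel_iff) auto
qed

section \<open>From the moment hypotheses to isotropic laws, and the final bound\<close>

lemma (in prob_space) isotropic_measure_distr:
  fixes Y :: "'a \<Rightarrow> real ^ 'd::finite"
  assumes [measurable]: "Y \<in> borel_measurable M"
    and mean: "(\<integral>\<omega>. Y \<omega> \<partial>M) = 0"
    and cov: "(\<integral>\<omega>. (\<chi> j k. Y \<omega> $ j * Y \<omega> $ k) \<partial>M) = (mat 1 :: real ^ 'd ^ 'd)"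
    and int: "integrable M (\<lambda>\<omega>. norm (Y \<omega>))"
  shows "isotropic_measure (distr M borel Y)"
proof -
  interpret D: prob_space "distr M borel Y" by (rule prob_space_distr) simp
  have iY: "integrable M Y"
    using int by (subst (asm) integrable_norm_iff) auto
  \<comment> \<open>A non-integrable function has integral 0, which is not the identity matrix.\<close>
  have iC: "integrable M (\<lambda>\<omega>. (\<chi> j k. Y \<omega> $ j * Y \<omega> $ k) :: real ^ 'd ^ 'd)"
  proof (rule ccontr)
    assume "\<not> ?thesis"
    then have "(mat 1 :: real ^ 'd ^ 'd) = 0"
      using cov by (simp add: not_integrable_integral_eq)
    then show False
      by (auto simp: mat_def vec_eq_iff split: if_splits)
  qed
  have bl: "bounded_linear (\<lambda>A :: real ^ 'd ^ 'd. A $ j $ k)" for j k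
    using bounded_linear_compose[OF bounded_linear_vec_nth bounded_linear_vec_nth] .
  have ic: "integrable M (\<lambda>\<omega>. Y \<omega> $ j * Y \<omega> $ k)" for j k
    using integrable_bounded_linear[OF bl[of j k] iC] by simp
  have c: "(\<integral>\<omega>. Y \<omega> $ j * Y \<omega> $ k \<partial>M) = (if j = k then 1 else 0)" for j k
    using integral_bounded_linear[OF bl[of j k] iC] cov by (simp add: mat_def)
  have B: "\<exists>j. b = axis j 1" if "b \<in> Basis" for b :: "real ^ 'd"
    using that by (auto simp: Basis_vec_def)
  show ?thesis
  proof
    fix b c' :: "real ^ 'd"
    assume b: "b \<in> Basis"
    show "(\<integral>x. x \<bullet> b \<partial>(distr M borel Y)) = 0"
      using mean iY by (subst integral_distr) auto
    assume c': "c' \<in> Basis"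
    obtain j k where jk: "b = axis j 1" "c' = axis k 1"
      using B[OF b] B[OF c'] by blast
    show "integrable (distr M borel Y) (\<lambda>x. (x \<bullet> b) * (x \<bullet> c'))"
      using ic[of j k] by (subst integrable_distr_eq) (auto simp: jk inner_axis)
    show "(\<integral>x. (x \<bullet> b) * (x \<bullet> c') \<partial>(distr M borel Y)) = (if b = c' then 1 else 0)"
      using c[of j k] by (subst integral_distr) (auto simp: jk inner_axis axis_eq_axis)
  qed simp
qed

lemma density_std_normal_vec_eq_gauss:
  "density lborel (\<lambda>x. ennreal (std_normal_vec_density x)) = (gauss :: (real ^ 'd::finite) measure)"
  by (simp add: gauss_def gauss_density_eq std_normal_vec_density_def)

theorem theorem1p1:
  fixes M :: "'a measure" and N :: "'b measure"
    and X :: "nat \<Rightarrow> 'a \<Rightarrow> real ^ 'd::finite"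
    and Z :: "'b \<Rightarrow> real ^ 'd"
    and \<delta> :: real and n i :: nat
  assumes "prob_space M" and "prob_space N"
    and indep: "prob_space.indep_vars M (\<lambda>_. borel) X {1..}"
    and ident: "\<And>j. j \<ge> 1 \<Longrightarrow> distr M borel (X j) = distr M borel (X 1)"
    and centered: "(\<integral>\<omega>. X 1 \<omega> \<partial>M) = 0"
    and unit_cov: "(\<integral>\<omega>. (\<chi> j k. X 1 \<omega> $ j * X 1 \<omega> $ k) \<partial>M) = (mat 1 :: real ^ 'd ^ 'd)"
    and Z: "distributed N lborel Z (\<lambda>x. ennreal (std_normal_vec_density x))"
    and \<delta>: "0 < \<delta>" "\<delta> < 1"
    and moment: "integrable M (\<lambda>\<omega>. norm (X 1 \<omega>) powr (2 + \<delta>))"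
    and n: "n \<ge> 1" and i: "i \<ge> 1"
  shows "wasserstein
           (distr M borel (\<lambda>\<omega>. real n powr (- 1 / 2) *\<^sub>R (\<Sum>j = 1..n. X j \<omega>)))
           (distr N borel Z)
         \<le> ereal (1 / real n powr (\<delta> / 2) *
             ((K1 CARD('d) + 2 / (1 - \<delta>)) * (\<integral>\<omega>. norm (X i \<omega>) powr (2 + \<delta>) \<partial>M)
              + (K2 CARD('d) + 2 * real CARD('d) / (1 - \<delta>)) * (\<integral>\<omega>. norm (X i \<omega>) powr \<delta> \<partial>M)))"
proof -
  interpret prob_space M by fact
  define \<mu> where "\<mu> = distr M borel (X 1)"
  have Xm [measurable]: "X j \<in> borel_measurable M" if "j \<ge> 1" for j
    using indep that by (auto simp: indep_vars_def)
  have law: "distr M borel (X j) = \<mu>" if "j \<ge> 1" for j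
    unfolding \<mu>_def using that by (rule ident)
  have norm_le: "norm x \<le> 1 + norm x powr (2 + \<delta>)" for x :: "real ^ 'd"
  proof (cases "norm x \<le> 1")
    case False
    then have "norm x powr 1 \<le> norm x powr (2 + \<delta>)"
      using \<delta> by (intro powr_mono) auto
    then show ?thesis using False by simp
  qed (use powr_ge_zero[of "norm x" "2 + \<delta>"] in linarith)
  have "integrable M (\<lambda>\<omega>. norm (X 1 \<omega>))"
  proof (rule Bochner_Integration.integrable_bound)
    show "integrable M (\<lambda>\<omega>. 1 + norm (X 1 \<omega>) powr (2 + \<delta>))"
      using moment by simp
    show "AE \<omega> in M. norm (norm (X 1 \<omega>)) \<le> norm (1 + norm (X 1 \<omega>) powr (2 + \<delta>))"
      using norm_le by (simp add: add_nonneg_nonneg)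
  qed simp
  then interpret \<mu>: isotropic_measure \<mu>
    unfolding \<mu>_def using centered unit_cov by (intro isotropic_measure_distr) auto
  have m_eq: "(\<integral>\<omega>. norm (X i \<omega>) powr (2 + \<delta>) \<partial>M) = (\<integral>x. norm x powr (2 + \<delta>) \<partial>\<mu>)"
    unfolding \<mu>_def ident[OF i, symmetric] using i by (subst integral_distr) auto
  have m: "integrable \<mu> (\<lambda>x. norm x powr (2 + \<delta>))"
    unfolding \<mu>_def using moment by (subst integrable_distr_eq) auto
  define m where "m = (\<integral>x. norm x powr (2 + \<delta>) \<partial>\<mu>)"
  \<comment> \<open>The dimension is at least 1, so its square root is below its power 1 + \<delta>
    / 2, which in turn is below the moment m by \<open>norm_powr_moment_ge\<close>.\<close>
  have "sqrt CARD('d) \<le> real CARD('d) powr (1 + \<delta> / 2)"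
    using \<delta> by (simp flip: powr_half_sqrt) (intro powr_mono, auto simp: Suc_le_eq)
  then have d_le: "sqrt CARD('d) \<le> m"
    using \<mu>.norm_powr_moment_ge[OF m] \<delta> by (simp add: m_def)
  have m0: "0 \<le> m" by (simp add: m_def)
  \<comment> \<open>The swaps with smoothing exceed 2 / (1 - \<delta>) times m by at most 2 m, since
    (2 + \<delta>) / 3 powr \<delta> \<le> 2 - \<delta>; the last swap costs at most another 2 m.
    The total excess of 4 m is covered by \<open>K1\<close>.\<close>
  have const: "2 / (1 - \<delta>) * ((2 + \<delta>) / 3 powr \<delta>) * m + 2 * sqrt CARD('d)
      \<le> (K1 CARD('d) + 2 / (1 - \<delta>)) * m"
  proof -
    have "(2 + \<delta>) / 3 powr \<delta> \<le> 1 + (1 - \<delta>)"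
      using two_plus_le_powr[of \<delta>] \<delta> by (simp add: divide_le_eq)
    then have "2 / (1 - \<delta>) * ((2 + \<delta>) / 3 powr \<delta>) \<le> 2 / (1 - \<delta>) * (1 + (1 - \<delta>))"
      using \<delta> by (intro mult_left_mono) auto
    also have "\<dots> = 2 / (1 - \<delta>) + 2"
      using \<delta> by (simp add: field_simps)
    finally have "2 / (1 - \<delta>) * ((2 + \<delta>) / 3 powr \<delta>) * m \<le> (2 / (1 - \<delta>) + 2) * m"
      using m0 by (rule mult_right_mono)
    moreover have "4 * m \<le> K1 CARD('d) * m"
      using K1_ge_4[of "CARD('d)"] m0 by (intro mult_right_mono) (auto simp: Suc_le_eq)
    ultimately show ?thesis
      using d_le by (simp add: distrib_right)
  qed
  have rest: "0 \<le> (K2 CARD('d) + 2 * real CARD('d) / (1 - \<delta>)) * (\<integral>\<omega>. norm (X i \<omega>) powr \<delta> \<partial>M)"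
    using \<delta> by (intro mult_nonneg_nonneg add_nonneg_nonneg) (auto simp: K2_def)
  \<comment> \<open>\<open>distributed\<close> takes \<open>lborel\<close> as target while the
    distance is stated over \<open>borel\<close>; the two have the same measurable sets.\<close>
  have "distr N borel Z = distr N lborel Z"
    by (rule distr_cong) auto
  then have Z_law: "distr N borel Z = gauss"
    using Z by (simp add: distributed_distr_eq_density density_std_normal_vec_eq_gauss)
  have n_powr: "real n powr (- 1 / 2) = 1 / sqrt n"
    by (simp add: powr_minus_divide powr_half_sqrt)
  show ?thesis
    unfolding wasserstein_def Z_law
  proof (rule SUP_least)
    fix h :: "real ^ 'd \<Rightarrow> real" assume "h \<in> {h. 1-lipschitz_on UNIV h}"
    then have h: "1-lipschitz_on UNIV h" by simp
    note [measurable] = lipschitz_borel_measurable[OF h]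
    have "(\<integral>x. h x \<partial>(distr M borel (\<lambda>\<omega>. real n powr (- 1 / 2) *\<^sub>R (\<Sum>j = 1..n. X j \<omega>))))
        = (\<integral>\<omega>. h ((1 / sqrt n) *\<^sub>R (\<Sum>j = 1..n. X j \<omega>)) \<partial>M)"
      unfolding n_powr by (subst integral_distr) auto
    moreover have "\<bar>(\<integral>\<omega>. h ((1 / sqrt n) *\<^sub>R (\<Sum>j = 1..n. X j \<omega>)) \<partial>M) - (\<integral>z. h z \<partial>gauss)\<bar>
        \<le> 1 / n powr (\<delta> / 2) * (2 / (1 - \<delta>) * ((2 + \<delta>) / 3 powr \<delta>) * m + 2 * sqrt CARD('d))"
      using lindeberg_swapping[OF indep law \<mu>.isotropic_measure_axioms \<delta> m h n]
      by (simp add: m_def)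
    moreover have "1 / n powr (\<delta> / 2) * (2 / (1 - \<delta>) * ((2 + \<delta>) / 3 powr \<delta>) * m + 2 * sqrt CARD('d))
        \<le> 1 / n powr (\<delta> / 2) * ((K1 CARD('d) + 2 / (1 - \<delta>)) * m
          + (K2 CARD('d) + 2 * real CARD('d) / (1 - \<delta>)) * (\<integral>\<omega>. norm (X i \<omega>) powr \<delta> \<partial>M))"
      using const rest by (intro mult_left_mono) auto
    ultimately show "ereal ((\<integral>x. h x \<partial>(distr M borel (\<lambda>\<omega>. real n powr (- 1 / 2) *\<^sub>R (\<Sum>j = 1..n. X j \<omega>))))
        - (\<integral>x. h x \<partial>gauss))
      \<le> ereal (1 / real n powr (\<delta> / 2) *
             ((K1 CARD('d) + 2 / (1 - \<delta>)) * (\<integral>\<omega>. norm (X i \<omega>) powr (2 + \<delta>) \<partial>M)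
              + (K2 CARD('d) + 2 * real CARD('d) / (1 - \<delta>)) * (\<integral>\<omega>. norm (X i \<omega>) powr \<delta> \<partial>M)))"
      unfolding m_eq m_def[symmetric] by simp
  qed
qed

end
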